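(* Let $1\le n\le 3$, $0<\alpha\le 1$, $B>0$, $\rho_\pm>0$, and suppose $(\rho_+,u_+)\in \mathrm{V}(\rho_-,u_-)$, i.e. $u_++\sqrt{B}\rho_+^{-\frac{\alpha+1}{2}}\le u_--\sqrt{B}\rho_-^{-\frac{\alpha+1}{2}}$. Let $A_0>0$ be such that $(\rho_+,u_+)\in S_1S_2^{AB}(\rho_-,u_-)$ for all $0<A<A_0$, and for $0<A<A_0$ let $(\rho^A,u^A)$ be the two-shock Riemann solution of the extended Chaplygin gas equations with Riemann data $(\rho_\pm,u_\pm)$. Then, as $A\to0$ ($B$ fixed), $\rho^A$ and $\rho^Au^A$ converge in the sense of distributions, and the limits of $\rho^A$ and $\rho^Au^A$ are each the sum of a step function and a $\delta$-measure supported on $S=\{(\sigma^Bt,t):t\ge0\}$ with weights $$w_1(t)=\frac{t}{\sqrt{1+(\sigma^B)^2}}(\sigma^B[\rho]-[\rho u])\quad\text{and}\quad w_2(t)=\frac{t}{\sqrt{1+(\sigma^B)^2}}\Big(\sigma^B[\rho u]-\Big[\rho u^2-\frac{B}{\rho^\alpha}\Big]\Big),$$ respectively, which form a $\delta$-shock solution of the generalized Chaplygin gas equations $\rho_t+(\rho u)_x=0$, $(\rho u)_t+(\rho u^2-\frac{B}{\rho^\alpha})_x=0$ with the same Riemann data $(\rho_\pm,u_\pm)$.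
   Context: For $A,B>0$, the extended Chaplygin gas equations are $\rho_t+(\rho u)_x=0$, $(\rho u)_t+(\rho u^2+P)_x=0$ with $P=A\rho^n-B\rho^{-\alpha}$; Riemann data means $(\rho,u)(x,0)=(\rho_\pm,u_\pm)$ for $\pm x>0$. For $a,b>0$ put $$\Phi_{AB}(a,b)=\sqrt{\frac{a-b}{ab}\Big(A(a^n-b^n)-B\big(\tfrac1{a^\alpha}-\tfrac1{b^\alpha}\big)\Big)}.$$ The region $S_1S_2^{AB}(\rho_-,u_-)$ is the set of $(\rho,u)$, $\rho>0$, with $u-u_-<-\Phi_{AB}(\rho,\rho_-)$. For $(\rho_+,u_+)$ in this region, the two-shock Riemann solution is, with $\xi=x/t$, equal to $(\rho_-,u_-)$ for $\xi<\sigma_1^A$, $(\rho_*^A,u_*^A)$ for $\sigma_1^A<\xi<\sigma_2^A$, and $(\rho_+,u_+)$ for $\xi>\sigma_2^A$, where $\rho_*^A>\max\{\rho_-,\rho_+\}$, $u_*^A-u_-=-\Phi_{AB}(\rho_*^A,\rho_-)$, $u_+-u_*^A=-\Phi_{AB}(\rho_+,\rho_*^A)$, $\sigma_1^A=\frac{\rho_*^Au_*^A-\rho_-u_-}{\rho_*^A-\rho_-}$, $\sigma_2^A=\frac{\rho_+u_+-\rho_*^Au_*^A}{\rho_+-\rho_*^A}$. Notation: $[q]=q_+-q_-$, e.g. $[\rho u^2-\frac{B}{\rho^\alpha}]=\rho_+u_+^2-\frac{B}{\rho_+^\alpha}-\rho_-u_-^2+\frac{B}{\rho_-^\alpha}$,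 and $$\sigma^B=\frac{\rho_+u_+-\rho_-u_-+\Big\{\rho_+\rho_-\Big((u_+-u_-)^2-\big(\frac1{\rho_+}-\frac1{\rho_-}\big)\big(\frac{B}{\rho_+^\alpha}-\frac{B}{\rho_-^\alpha}\big)\Big)\Big\}^{1/2}}{\rho_+-\rho_-}\ \text{ if }\rho_+\ne\rho_-,\qquad \sigma^B=\frac{u_++u_-}{2}\ \text{ if }\rho_+=\rho_-.$$ The step functions are $\rho_0$, equal to $\rho_-$ for $x<\sigma^Bt$ and $\rho_+$ for $x>\sigma^Bt$, in the limit of $\rho^A$, and $\rho_0u_0$, equal to $\rho_-u_-$ for $x<\sigma^Bt$ and $\rho_+u_+$ for $x>\sigma^Bt$, in the limit of $\rho^Au^A$. For a smooth curve $S=\{(x(s),t(s)):a\le s\le b\}$ the weighted $\delta$-measure is $\langle w\delta_S,\psi\rangle=\int_a^b w(s)\psi(x(s),t(s))\sqrt{x'(s)^2+t'(s)^2}\,ds$; here $S$ is parametrized by $t$. That the limits form a $\delta$-shock solution of the generalized Chaplygin gas equations means: the velocity on $S$ is $\sigma^B$, the term $B/\rho^\alpha$ is taken to be $0$ on $S$, and for all $\psi\in C_0^\infty(\mathbb{R}\times\mathbb{R}_+)$ one has $\langle\rho,\psi_t\rangle+\langle\rho u,\psi_x\rangle=0$ and $\langle\rho u,\psi_t\rangle+\langle\rho u^2-\frac{B}{\rho^\alpha},\psi_x\rangle=0$, where $\langle\rho,\psi\rangle=\int_0^\infty\!\int_{-\infty}^\infty\rho_0\psi\,dx\,dt+\langle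 w_1\delta_S,\psi\rangle$, $\langle\rho u,\psi\rangle=\int_0^\infty\!\int_{-\infty}^\infty\rho_0u_0\psi\,dx\,dt+\langle w_2\delta_S,\psi\rangle$, $\langle\rho u^2-\frac{B}{\rho^\alpha},\psi\rangle=\int_0^\infty\!\int_{-\infty}^\infty(\rho_0u_0^2-\frac{B}{\rho_0^\alpha})\psi\,dx\,dt+\langle\sigma^Bw_2\delta_S,\psi\rangle$, with $u_0=u_\mp$ for $\mp(x-\sigma^Bt)>0$. *)

theory Defs
  imports "HOL-Analysis.Analysis"
begin

text \<open>
  Points of the space-time plane are pairs \<open>(x, t)\<close>. A subscript \<open>m\<close> (resp. \<open>p\<close>) stands for the
  left (minus) resp. right (plus) Riemann state. The parameters \<open>n\<close> and \<open>\<alpha>\<close> are real exponents.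
\<close>

definition Phi :: "real \<Rightarrow> real \<Rightarrow> real \<Rightarrow> real \<Rightarrow> real \<Rightarrow> real \<Rightarrow> real" where
  "Phi A B n \<alpha> a b =
     sqrt ((a - b) / (a * b) *
       (A * (a powr n - b powr n) - B * (1 / a powr \<alpha> - 1 / b powr \<alpha>)))"

definition region_S1S2 :: "real \<Rightarrow> real \<Rightarrow> real \<Rightarrow> real \<Rightarrow> real \<Rightarrow> real \<Rightarrow> (real \<times> real) set" where
  "region_S1S2 A B n \<alpha> \<rho>m um = {(\<rho>, u). \<rho> > 0 \<and> u - um < - Phi A B n \<alpha> \<rho> \<rho>m}"

definition region_V :: "real \<Rightarrow> real \<Rightarrow> real \<Rightarrow> real \<Rightarrow> (real \<times> real) set" where
  "region_V B \<alpha> \<rho>m um =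
     {(\<rho>, u). \<rho> > 0 \<and>
        u + sqrt B * \<rho> powr (- ((\<alpha> + 1) / 2)) \<le> um - sqrt B * \<rho>m powr (- ((\<alpha> + 1) / 2))}"

text \<open>
  The fields are constrained for \<open>t > 0\<close> only, and their values on the two shock lines
  (a null set) are arbitrary.
\<close>

definition two_shock_solution ::
  "real \<Rightarrow> real \<Rightarrow> real \<Rightarrow> real \<Rightarrow> real \<Rightarrow> real \<Rightarrow> real \<Rightarrow> real \<Rightarrow>
   (real \<times> real \<Rightarrow> real) \<Rightarrow> (real \<times> real \<Rightarrow> real) \<Rightarrow> bool" where
  "two_shock_solution A B n \<alpha> \<rho>m um \<rho>p up \<rho> u \<longleftrightarrow>
     (\<exists>\<rho>s us.
        \<rho>s > max \<rho>m \<rho>p \<and>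
        us - um = - Phi A B n \<alpha> \<rho>s \<rho>m \<and>
        up - us = - Phi A B n \<alpha> \<rho>p \<rho>s \<and>
        (let \<sigma>1 = (\<rho>s * us - \<rho>m * um) / (\<rho>s - \<rho>m);
             \<sigma>2 = (\<rho>p * up - \<rho>s * us) / (\<rho>p - \<rho>s)
         in \<forall>x t. t > 0 \<longrightarrow>
              (x / t < \<sigma>1 \<longrightarrow> \<rho> (x, t) = \<rho>m \<and> u (x, t) = um) \<and>
              (\<sigma>1 < x / t \<and> x / t < \<sigma>2 \<longrightarrow> \<rho> (x, t) = \<rho>s \<and> u (x, t) = us) \<and>
              (x / t > \<sigma>2 \<longrightarrow> \<rho> (x, t) = \<rho>p \<and> u (x, t) = up)))"

definition sigmaB :: "real \<Rightarrow> real \<Rightarrow> real \<Rightarrow> real \<Rightarrow> real \<Rightarrow> real \<Rightarrow> real" where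
  "sigmaB B \<alpha> \<rho>m um \<rho>p up =
     (if \<rho>p \<noteq> \<rho>m then
        (\<rho>p * up - \<rho>m * um +
          sqrt (\<rho>p * \<rho>m * ((up - um)\<^sup>2 -
            (1 / \<rho>p - 1 / \<rho>m) * (B / \<rho>p powr \<alpha> - B / \<rho>m powr \<alpha>)))) / (\<rho>p - \<rho>m)
      else (up + um) / 2)"

text \<open>Momentum flux of the generalized Chaplygin gas.\<close>

definition gcg_flux :: "real \<Rightarrow> real \<Rightarrow> real \<Rightarrow> real \<Rightarrow> real" where
  "gcg_flux B \<alpha> \<rho> u = \<rho> * u\<^sup>2 - B / \<rho> powr \<alpha>"

text \<open>
  Continuous differentiability of order \<open>k\<close>, through iterated directional derivatives; on a
  finite-dimensional space this is the usual notion.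
\<close>

primrec C_k :: "nat \<Rightarrow> ('a::euclidean_space \<Rightarrow> real) \<Rightarrow> bool" where
  "C_k 0 f \<longleftrightarrow> continuous_on UNIV f"
| "C_k (Suc k) f \<longleftrightarrow>
     (\<forall>x. f differentiable (at x)) \<and> (\<forall>v. C_k k (\<lambda>x. frechet_derivative f (at x) v))"

text \<open>
  \<open>C\<^sub>0\<^sup>\<infinity>(\<real> \<times> \<real>\<^sub>+)\<close> with \<open>\<real>\<^sub>+ = (0, \<infinity>)\<close>; test functions are extended by zero to the whole plane.
\<close>

definition test_function :: "(real \<times> real \<Rightarrow> real) \<Rightarrow> bool" where
  "test_function \<psi> \<longleftrightarrow>
     (\<forall>k. C_k k \<psi>) \<and>
     compact (closure {p. \<psi> p \<noteq> 0}) \<and> closure {p. \<psi> p \<noteq> 0} \<subseteq> UNIV \<times> {0<..}"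

definition partial_x :: "(real \<times> real \<Rightarrow> real) \<Rightarrow> real \<times> real \<Rightarrow> real" where
  "partial_x \<psi> = (\<lambda>(x, t). deriv (\<lambda>y. \<psi> (y, t)) x)"

definition partial_t :: "(real \<times> real \<Rightarrow> real) \<Rightarrow> real \<times> real \<Rightarrow> real" where
  "partial_t \<psi> = (\<lambda>(x, t). deriv (\<lambda>s. \<psi> (x, s)) t)"

text \<open>The pairing of a function on the upper half-plane with a test function.\<close>

definition pairing :: "(real \<times> real \<Rightarrow> real) \<Rightarrow> (real \<times> real \<Rightarrow> real) \<Rightarrow> real" where
  "pairing f \<psi> = (LBINT t:{0<..}. (LBINT x. f (x, t) * \<psi> (x, t)))"

text \<open>
  The weighted delta measure on the curve \<open>s \<mapsto> (X s, T s)\<close>, \<open>s \<in> I\<close>; the parameter interval \<open>I\<close> may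
  be unbounded.
\<close>

definition weighted_delta ::
  "(real \<Rightarrow> real) \<Rightarrow> (real \<Rightarrow> real) \<Rightarrow> (real \<Rightarrow> real) \<Rightarrow> real set \<Rightarrow> (real \<times> real \<Rightarrow> real) \<Rightarrow> real" where
  "weighted_delta w X T I \<psi> =
     (LBINT s:I. w s * \<psi> (X s, T s) * sqrt ((deriv X s)\<^sup>2 + (deriv T s)\<^sup>2))"

text \<open>
  The sum of the function \<open>f\<close> and of the delta measure with weight \<open>w\<close> on the ray
  \<open>{(\<sigma> t, t) | t \<ge> 0}\<close>, parametrized by \<open>t\<close>.
\<close>

definition singular_pairing ::
  "real \<Rightarrow> (real \<times> real \<Rightarrow> real) \<Rightarrow> (real \<Rightarrow> real) \<Rightarrow> (real \<times> real \<Rightarrow> real) \<Rightarrow> real" where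
  "singular_pairing \<sigma> f w \<psi> =
     pairing f \<psi> + weighted_delta w (\<lambda>t. \<sigma> * t) (\<lambda>t. t) {0..} \<psi>"

text \<open>Convergence in the sense of distributions as the parameter tends to zero from the right.\<close>

definition converges_as_distribution ::
  "(real \<Rightarrow> real \<times> real \<Rightarrow> real) \<Rightarrow> ((real \<times> real \<Rightarrow> real) \<Rightarrow> real) \<Rightarrow> bool" where
  "converges_as_distribution f L \<longleftrightarrow>
     (\<forall>\<psi>. test_function \<psi> \<longrightarrow> ((\<lambda>A. pairing (f A) \<psi>) \<longlongrightarrow> L \<psi>) (at_right 0))"

text \<open>The value on the null line \<open>x = \<sigma> t\<close> is immaterial.\<close>

definition step_fun :: "real \<Rightarrow> real \<Rightarrow> real \<Rightarrow> real \<times> real \<Rightarrow> real" where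
  "step_fun \<sigma> l r = (\<lambda>(x, t). if x < \<sigma> * t then l else r)"

text \<open>
  Delta-shock solution of the generalized Chaplygin gas equations with regular part \<open>(\<rho>\<^sub>0, u\<^sub>0)\<close> and
  with density and momentum weights \<open>w\<^sub>1\<close>, \<open>w\<^sub>2\<close> on the ray \<open>x = \<sigma> t\<close>. The velocity on the ray is
  \<open>\<sigma>\<close> and \<open>B / \<rho>\<^sup>\<alpha>\<close> vanishes there, so the momentum flux carries the weight \<open>\<sigma> w\<^sub>2\<close>.
\<close>

definition delta_shock_solution ::
  "real \<Rightarrow> real \<Rightarrow> real \<Rightarrow> real \<Rightarrow> real \<Rightarrow> real \<Rightarrow> real \<Rightarrow>
   (real \<times> real \<Rightarrow> real) \<Rightarrow> (real \<times> real \<Rightarrow> real) \<Rightarrow> (real \<Rightarrow> real) \<Rightarrow> (real \<Rightarrow> real) \<Rightarrow> bool" where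
  "delta_shock_solution B \<alpha> \<rho>m um \<rho>p up \<sigma> \<rho>0 u0 w1 w2 \<longleftrightarrow>
     (\<forall>x<0. \<rho>0 (x, 0) = \<rho>m \<and> u0 (x, 0) = um) \<and>
     (\<forall>x>0. \<rho>0 (x, 0) = \<rho>p \<and> u0 (x, 0) = up) \<and>
     (\<forall>\<psi>. test_function \<psi> \<longrightarrow>
        singular_pairing \<sigma> \<rho>0 w1 (partial_t \<psi>) +
        singular_pairing \<sigma> (\<lambda>z. \<rho>0 z * u0 z) w2 (partial_x \<psi>) = 0 \<and>
        singular_pairing \<sigma> (\<lambda>z. \<rho>0 z * u0 z) w2 (partial_t \<psi>) +
        singular_pairing \<sigma> (\<lambda>z. gcg_flux B \<alpha> (\<rho>0 z) (u0 z)) (\<lambda>t. \<sigma> * w2 t) (partial_x \<psi>) = 0)"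

end

theory Submission
  imports Defs
begin

text \<open>
  Write \<open>a\<close>, \<open>v\<close> for the density and velocity between the shocks. For bounded \<open>a\<close> the jump
  \<open>um - up = \<Phi>(a, \<rho>m) + \<Phi>(a, \<rho>p)\<close> would stay strictly below the threshold defining the region V as
  \<open>A \<rightarrow> 0\<close>, so \<open>a \<rightarrow> \<infinity>\<close>. In the difference of the squared shock relations, each divided by its factor
  \<open>1 / \<rho>\<^sub>\<plusminus> - 1 / a\<close>, the uncontrolled term \<open>A a\<^sup>n\<close> cancels; hence
  \<open>\<rho>m (um - v)\<^sup>2 - \<rho>p (v - up)\<^sup>2\<close>, a strictly monotone function of \<open>v\<close> on \<open>[up, um]\<close>, converges to
  its value at \<open>\<sigma>\<close>, and \<open>v \<rightarrow> \<sigma>\<close>. Both shock speeds then tend to \<open>\<sigma>\<close>, while \<open>a\<close> times their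
  difference tends to \<open>\<sigma>[\<rho>] - [\<rho>u]\<close>, so the middle state concentrates into a delta measure.
  The weak equations follow by integrating by parts along lines parallel to the front.
\<close>

subsection \<open>The intermediate state as \<open>A \<rightarrow> 0\<close>\<close>

lemma Phi_commute: "Phi A B n \<alpha> a b = Phi A B n \<alpha> b a"
  unfolding Phi_def by (simp add: algebra_simps diff_divide_distrib)

text \<open>For b < a, monotonicity of the powers makes both factors of the radicand nonnegative.
  The first factor is kept as 1/b - 1/a because the comparison of the two squared shock relations
  divides by it.\<close>

lemma Phi_nonneg:
  assumes "0 < b" "b < a" "0 \<le> A" "0 \<le> B" "0 \<le> n" "0 \<le> \<alpha>"
  shows "0 \<le> Phi A B n \<alpha> a b"
    and "(Phi A B n \<alpha> a b)\<^sup>2 =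
      (1 / b - 1 / a) * (A * (a powr n - b powr n) + B * (1 / b powr \<alpha> - 1 / a powr \<alpha>))"
proof -
  have "b powr n \<le> a powr n" "b powr \<alpha> \<le> a powr \<alpha>"
    using assms by (auto intro!: powr_mono2)
  moreover have "0 < b powr \<alpha>" using assms by simp
  moreover have "0 < a powr \<alpha>" using assms by simp
  ultimately have "1 / a powr \<alpha> \<le> 1 / b powr \<alpha>" by (intro divide_left_mono mult_pos_pos) auto
  moreover have "1 / a \<le> 1 / b" using assms by (intro divide_left_mono) auto
  ultimately have nn: "0 \<le> (1 / b - 1 / a) * (A * (a powr n - b powr n) + B * (1 / b powr \<alpha> - 1 / a powr \<alpha>))"
    using assms \<open>b powr n \<le> a powr n\<close> by (intro mult_nonneg_nonneg add_nonneg_nonneg) auto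
  have eq1: "(a - b) / (a * b) = 1 / b - 1 / a" using assms by (simp add: field_simps)
  have eq2: "B * (1 / a powr \<alpha> - 1 / b powr \<alpha>) = - (B * (1 / b powr \<alpha> - 1 / a powr \<alpha>))"
    by (simp add: algebra_simps)
  have eq: "Phi A B n \<alpha> a b =
      sqrt ((1 / b - 1 / a) * (A * (a powr n - b powr n) + B * (1 / b powr \<alpha> - 1 / a powr \<alpha>)))"
    unfolding Phi_def eq1 eq2 by simp
  show "0 \<le> Phi A B n \<alpha> a b" unfolding eq using nn by simp
  show "(Phi A B n \<alpha> a b)\<^sup>2 =
      (1 / b - 1 / a) * (A * (a powr n - b powr n) + B * (1 / b powr \<alpha> - 1 / a powr \<alpha>))"
    unfolding eq using nn by (simp add: real_sqrt_pow2)
qed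

text \<open>The terms in a are replaced by their values at M, and the subtracted
  \<open>A * b powr n\<close> is dropped. The bound no longer contains a and is continuous in A, so
  A can tend to 0 in it.\<close>

lemma Phi_le:
  assumes "0 < b" "b < a" "a \<le> M" "0 \<le> A" "0 \<le> B" "0 \<le> n" "0 \<le> \<alpha>"
  shows "Phi A B n \<alpha> a b \<le> sqrt ((1 / b - 1 / M) * (A * M powr n + B * (1 / b powr \<alpha> - 1 / M powr \<alpha>)))"
proof (rule real_le_rsqrt)
  have p: "b powr n \<le> a powr n" "a powr n \<le> M powr n" "b powr \<alpha> \<le> a powr \<alpha>" "a powr \<alpha> \<le> M powr \<alpha>"
    using assms by (auto intro!: powr_mono2)
  have pos: "0 < b powr \<alpha>" "0 < a powr \<alpha>" "0 < M powr \<alpha>" "0 \<le> b powr n" using assms by auto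
  have q: "1 / a powr \<alpha> \<le> 1 / b powr \<alpha>" "1 / M powr \<alpha> \<le> 1 / a powr \<alpha>"
    using p pos by (auto intro!: divide_left_mono)
  have r: "1 / a \<le> 1 / b" "1 / M \<le> 1 / a" using assms by (auto intro!: divide_left_mono)
  have "A * (a powr n - b powr n) \<le> A * M powr n"
    using p pos(4) assms(4) by (intro mult_left_mono) linarith+
  moreover have "B * (1 / b powr \<alpha> - 1 / a powr \<alpha>) \<le> B * (1 / b powr \<alpha> - 1 / M powr \<alpha>)"
    using q assms by (intro mult_left_mono) auto
  moreover have "0 \<le> A * (a powr n - b powr n)" "0 \<le> B * (1 / b powr \<alpha> - 1 / a powr \<alpha>)"
    using p q assms by auto
  ultimately show "(Phi A B n \<alpha> a b)\<^sup>2 \<le> (1 / b - 1 / M) * (A * M powr n + B * (1 / b powr \<alpha> - 1 / M powr \<alpha>))"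
    unfolding Phi_nonneg(2)[OF assms(1,2,4-7)] using r
    by (intro mult_mono) auto
qed

text \<open>Brings the terms that define the region V into the shape of the bound in
  \<open>Phi_le\<close>, with A = 0 and the subtracted terms in M removed, so that the two can be
  compared under the root.\<close>

lemma sqrt_times_powr_neg_half:
  assumes "0 < b" "0 \<le> B"
  shows "sqrt B * b powr (- ((\<alpha> + 1) / 2)) = sqrt (1 / b * (B * (1 / b powr \<alpha>)))"
proof -
  have "b powr (- ((\<alpha> + 1) / 2)) = sqrt (b powr (- (\<alpha> + 1)))"
    using assms by (simp add: powr_half_sqrt[symmetric] powr_powr flip: minus_add_distrib)
  also have "b powr (- (\<alpha> + 1)) = 1 / b * (1 / b powr \<alpha>)"
    using assms by (simp only: powr_minus_divide powr_add) simp
  finally show ?thesis by (simp add: real_sqrt_mult[symmetric] mult_ac)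
qed

lemma intermediate_density_at_top:
  fixes X a :: "nat \<Rightarrow> real"
  assumes pos: "0 < \<rho>m" "0 < \<rho>p" "0 < B" "0 \<le> n" "0 < \<alpha>"
    and X: "\<And>k. 0 < X k" "X \<longlonglongrightarrow> 0"
    and a: "\<And>k. max \<rho>m \<rho>p < a k"
    and eq: "\<And>k. um - up = Phi (X k) B n \<alpha> (a k) \<rho>m + Phi (X k) B n \<alpha> (a k) \<rho>p"
    and V: "sqrt B * \<rho>m powr (- ((\<alpha> + 1) / 2)) + sqrt B * \<rho>p powr (- ((\<alpha> + 1) / 2)) \<le> um - up"
  shows "filterlim a at_top sequentially"
  unfolding filterlim_at_top
proof
  fix Z
  \<comment> \<open>A bound Z on the density may be enlarged; M also lies strictly above both outer
    densities, which makes the comparison below strict.\<close>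
  define M where "M = max Z (\<rho>m + \<rho>p)"
  define F where "F b x = sqrt ((1 / b - 1 / M) * (x * M powr n + B * (1 / b powr \<alpha> - 1 / M powr \<alpha>)))" for b x
  have M: "\<rho>m < M" "\<rho>p < M" using pos by (auto simp: M_def)
  \<comment> \<open>The subtracted terms in M are strictly positive, so a bounded density falls
    short of V by a fixed amount. This gap is what contradicts the non-strict inequality of
    V.\<close>
  have lt: "F b 0 < sqrt B * b powr (- ((\<alpha> + 1) / 2))" if b: "0 < b" "b < M" for b
  proof -
    have "b powr \<alpha> < M powr \<alpha>" "0 < b powr \<alpha>" using b pos by (auto intro!: powr_less_mono2)
    then have "0 < 1 / M powr \<alpha>" "1 / M powr \<alpha> < 1 / b powr \<alpha>" using b
      by (auto simp: field_simps)
    moreover have "0 < 1 / M" "1 / M < 1 / b" using b by (auto simp: field_simps)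
    ultimately have "(1 / b - 1 / M) * (B * (1 / b powr \<alpha> - 1 / M powr \<alpha>)) < 1 / b * (B * (1 / b powr \<alpha>))"
      using pos b by (intro mult_strict_mono mult_strict_left_mono) auto
    then show ?thesis using b pos by (subst sqrt_times_powr_neg_half) (auto simp: F_def)
  qed
  have "(\<lambda>k. F \<rho>m (X k) + F \<rho>p (X k)) \<longlonglongrightarrow> F \<rho>m 0 + F \<rho>p 0"
    unfolding F_def by (intro tendsto_intros X)
  moreover have "F \<rho>m 0 + F \<rho>p 0 < um - up"
    using lt[of \<rho>m] lt[of \<rho>p] V M pos by linarith
  ultimately have "eventually (\<lambda>k. F \<rho>m (X k) + F \<rho>p (X k) < um - up) sequentially"
    by (rule order_tendstoD)
  then show "eventually (\<lambda>k. Z \<le> a k) sequentially"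
  proof eventually_elim
    case (elim k)
    show ?case
    proof (rule ccontr)
      assume "\<not> Z \<le> a k"
      then have "a k \<le> M" by (auto simp: M_def)
      then have "Phi (X k) B n \<alpha> (a k) \<rho>m \<le> F \<rho>m (X k)" "Phi (X k) B n \<alpha> (a k) \<rho>p \<le> F \<rho>p (X k)"
        unfolding F_def using a[of k] pos X(1)[of k] by (auto intro!: Phi_le)
      with elim eq[of k] show False by linarith
    qed
  qed
qed

text \<open>
  The quadratic equation below says that the momentum fluxes relative to a front moving with
  speed \<open>\<sigma>\<close> agree on both sides.
\<close>

lemma sigmaB_root:
  assumes pos: "0 < \<rho>m" "0 < \<rho>p" "0 < B"
    and V: "sqrt B * \<rho>m powr (- ((\<alpha> + 1) / 2)) + sqrt B * \<rho>p powr (- ((\<alpha> + 1) / 2)) \<le> um - up"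
  shows "up \<le> sigmaB B \<alpha> \<rho>m um \<rho>p up" "sigmaB B \<alpha> \<rho>m um \<rho>p up \<le> um"
    and "\<rho>m * (um - sigmaB B \<alpha> \<rho>m um \<rho>p up)\<^sup>2 - \<rho>p * (sigmaB B \<alpha> \<rho>m um \<rho>p up - up)\<^sup>2 =
      B * (1 / \<rho>m powr \<alpha> - 1 / \<rho>p powr \<alpha>)"
proof -
  define g where "g s = \<rho>m * (um - s)\<^sup>2 - \<rho>p * (s - up)\<^sup>2" for s
  define cm cp where "cm = B * (1 / \<rho>m powr \<alpha>)" and "cp = B * (1 / \<rho>p powr \<alpha>)"
  have c: "0 < cm" "0 < cp" using pos by (auto simp: cm_def cp_def)
  have V': "sqrt (1 / \<rho>m * cm) + sqrt (1 / \<rho>p * cp) \<le> um - up"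
    using V pos by (simp add: sqrt_times_powr_neg_half cm_def cp_def)
  moreover have sp: "0 < sqrt (1 / \<rho>m * cm)" "0 < sqrt (1 / \<rho>p * cp)" using c pos by auto
  \<comment> \<open>V bounds each root alone by um - up. This places cm - cp between
    \<open>g um\<close>, which is -\<rho>p (um - up)^2, and \<open>g up\<close>, which is \<rho>m
    (um - up)^2, as the intermediate value theorem requires.\<close>
  ultimately have "sqrt (1 / \<rho>m * cm) \<le> um - up" "sqrt (1 / \<rho>p * cp) \<le> um - up" and D: "0 < um - up"
    by linarith+
  then have "1 / \<rho>m * cm \<le> (um - up)\<^sup>2" "1 / \<rho>p * cp \<le> (um - up)\<^sup>2"
    by (auto intro: sqrt_le_D)
  then have "cm \<le> \<rho>m * (um - up)\<^sup>2" "cp \<le> \<rho>p * (um - up)\<^sup>2"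
    using pos by (auto simp: field_simps)
  then have "g um \<le> cm - cp" "cm - cp \<le> g up"
    using c by (auto simp: g_def)
  moreover have "continuous_on {up..um} g" unfolding g_def by (intro continuous_intros)
  ultimately obtain s where s: "up \<le> s" "s \<le> um" "g s = cm - cp"
    using IVT2'[of g um "cm - cp" up] D by auto
  have "sigmaB B \<alpha> \<rho>m um \<rho>p up = s"
  proof (cases "\<rho>p = \<rho>m")
    \<comment> \<open>With equal densities the terms in s^2 cancel, and the equation becomes linear
      with the mean velocity as its root.\<close>
    case True
    then have "\<rho>m * ((um - s)\<^sup>2 - (s - up)\<^sup>2) = 0" using s(3) by (simp add: g_def cm_def cp_def algebra_simps)
    moreover have "(um - s)\<^sup>2 - (s - up)\<^sup>2 = (um - up) * (um + up - 2 * s)"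
      by (simp add: power2_eq_square algebra_simps)
    ultimately have "(um - up) * (um + up - 2 * s) = 0" using pos by simp
    then show ?thesis using D True by (simp add: sigmaB_def)
  next
    case False
    \<comment> \<open>q is the candidate for the square root in \<open>sigmaB\<close>: its square is
      the radicand by the equation for s, and s in [up, um] makes it nonnegative, which singles out
      the plus sign.\<close>
    define q where "q = s * (\<rho>p - \<rho>m) - (\<rho>p * up - \<rho>m * um)"
    have "q = \<rho>p * (s - up) + \<rho>m * (um - s)" by (simp add: q_def algebra_simps)
    then have q0: "0 \<le> q" using s pos by simp
    have "\<rho>p * \<rho>m * ((up - um)\<^sup>2 - (1 / \<rho>p - 1 / \<rho>m) * (B / \<rho>p powr \<alpha> - B / \<rho>m powr \<alpha>)) =
        \<rho>p * \<rho>m * (up - um)\<^sup>2 - (\<rho>p - \<rho>m) * (cm - cp)"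
      using pos by (simp add: cm_def cp_def field_simps)
    also have "\<dots> = q\<^sup>2" unfolding s(3)[symmetric] g_def q_def
      by (simp add: power2_eq_square algebra_simps)
    finally have "sigmaB B \<alpha> \<rho>m um \<rho>p up = (\<rho>p * up - \<rho>m * um + q) / (\<rho>p - \<rho>m)"
      using q0 False by (simp add: sigmaB_def)
    then show ?thesis using False by (simp add: q_def)
  qed
  then show "up \<le> sigmaB B \<alpha> \<rho>m um \<rho>p up" "sigmaB B \<alpha> \<rho>m um \<rho>p up \<le> um"
    "\<rho>m * (um - sigmaB B \<alpha> \<rho>m um \<rho>p up)\<^sup>2 - \<rho>p * (sigmaB B \<alpha> \<rho>m um \<rho>p up - up)\<^sup>2 =
      B * (1 / \<rho>m powr \<alpha> - 1 / \<rho>p powr \<alpha>)"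
    using s by (auto simp: g_def cm_def cp_def algebra_simps)
qed

lemma intermediate_velocity_tendsto:
  fixes X a us :: "nat \<Rightarrow> real"
  assumes pos: "0 < \<rho>m" "0 < \<rho>p" "0 < B" "0 \<le> n" "0 < \<alpha>"
    and X: "\<And>k. 0 < X k" "X \<longlonglongrightarrow> 0"
    and a: "\<And>k. max \<rho>m \<rho>p < a k"
    and um: "\<And>k. um - us k = Phi (X k) B n \<alpha> (a k) \<rho>m"
    and up: "\<And>k. us k - up = Phi (X k) B n \<alpha> (a k) \<rho>p"
    and V: "sqrt B * \<rho>m powr (- ((\<alpha> + 1) / 2)) + sqrt B * \<rho>p powr (- ((\<alpha> + 1) / 2)) \<le> um - up"
  shows "filterlim a at_top sequentially"
    and "\<And>k. up \<le> us k" "\<And>k. us k \<le> um"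
    and "us \<longlonglongrightarrow> sigmaB B \<alpha> \<rho>m um \<rho>p up"
proof -
  show top: "filterlim a at_top sequentially"
    by (rule intermediate_density_at_top[OF pos X a _ V]) (use um up in smt)
  have ak: "\<rho>m < a k" "\<rho>p < a k" for k using a[of k] by auto
  show b: "up \<le> us k" "us k \<le> um" for k
    using Phi_nonneg(1)[of \<rho>p "a k" "X k" B n \<alpha>] Phi_nonneg(1)[of \<rho>m "a k" "X k" B n \<alpha>]
      um[of k] up[of k] pos X(1)[of k] ak[of k] by linarith+
  define s where "s = sigmaB B \<alpha> \<rho>m um \<rho>p up"
  define g where "g s = \<rho>m * (um - s)\<^sup>2 - \<rho>p * (s - up)\<^sup>2" for s
  note s = sigmaB_root[OF pos(1-3) V, folded s_def]
  define D where "D = um - up"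
  have D: "0 < D"
  proof -
    have "0 < sqrt B * \<rho>m powr (- ((\<alpha> + 1) / 2))" "0 < sqrt B * \<rho>p powr (- ((\<alpha> + 1) / 2))"
      using pos by auto
    then show ?thesis using V unfolding D_def by linarith
  qed
  \<comment> \<open>Both relations contain \<open>X k * a k powr n\<close> and the same
    \<open>B / a k powr \<alpha>\<close>, which cancel in the difference. What remains is a fixed
    multiple of \<open>X k\<close> and two terms with \<open>a k\<close> in the denominator.\<close>
  have gk: "g (us k) - g s = X k * (\<rho>p powr n - \<rho>m powr n)
      - (um - us k)\<^sup>2 * (\<rho>m\<^sup>2 / (a k - \<rho>m)) + (us k - up)\<^sup>2 * (\<rho>p\<^sup>2 / (a k - \<rho>p))" for k
  proof -
    \<comment> \<open>Division by 1/b - 1/c: the quotient bc/(c - b) is split as b + b^2/(c - b), so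
      that the leading coefficient is b.\<close>
    have *: "b * P\<^sup>2 = W - P\<^sup>2 * (b\<^sup>2 / (c - b))"
      if "0 < b" "b < c" "P\<^sup>2 = (1 / b - 1 / c) * W" for b c P W :: real
      unfolding that(3) using that(1,2) by (simp add: divide_simps) (simp add: power2_eq_square algebra_simps)
    have "\<rho>m * (um - us k)\<^sup>2 = X k * (a k powr n - \<rho>m powr n) + B * (1 / \<rho>m powr \<alpha> - 1 / a k powr \<alpha>)
       - (um - us k)\<^sup>2 * (\<rho>m\<^sup>2 / (a k - \<rho>m))"
      using pos X(1)[of k] ak[of k] unfolding um by (intro * Phi_nonneg(2)) auto
    moreover have "\<rho>p * (us k - up)\<^sup>2 = X k * (a k powr n - \<rho>p powr n) + B * (1 / \<rho>p powr \<alpha> - 1 / a k powr \<alpha>)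
       - (us k - up)\<^sup>2 * (\<rho>p\<^sup>2 / (a k - \<rho>p))"
      using pos X(1)[of k] ak[of k] unfolding up by (intro * Phi_nonneg(2)) auto
    ultimately show ?thesis using s(3) by (simp add: g_def algebra_simps)
  qed
  have inv: "(\<lambda>k. c / (a k - b)) \<longlonglongrightarrow> 0" for b c
    by (intro real_tendsto_divide_at_top[OF tendsto_const]
        filterlim_tendsto_add_at_top[OF tendsto_const[of "-b"] top, simplified])
  have bnd: "(um - us k)\<^sup>2 \<le> D\<^sup>2" "(us k - up)\<^sup>2 \<le> D\<^sup>2" for k
    using b[of k] by (auto intro!: power_mono simp: D_def)
  have "(\<lambda>k. X k * (\<rho>p powr n - \<rho>m powr n)
      - (um - us k)\<^sup>2 * (\<rho>m\<^sup>2 / (a k - \<rho>m)) + (us k - up)\<^sup>2 * (\<rho>p\<^sup>2 / (a k - \<rho>p)))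
      \<longlonglongrightarrow> 0 * (\<rho>p powr n - \<rho>m powr n) - 0 + 0"
    using bnd by (intro tendsto_intros X inv lim_null_mult_left_bounded[of _ "D\<^sup>2"]) auto
  then have g0: "(\<lambda>k. g (us k) - g s) \<longlonglongrightarrow> 0" by (simp add: gk)
  \<comment> \<open>The difference factors as \<open>s - us k\<close> times \<open>?d\<close>. The
    four distances in \<open>?d\<close> are nonnegative and sum to 2D, so \<open>?d\<close> is at
    least 2 min(\<rho>m, \<rho>p) D, and convergence of the values of g forces convergence of the
    arguments.\<close>
  have est: "\<bar>us k - s\<bar> \<le> \<bar>g (us k) - g s\<bar> * (1 / (2 * (min \<rho>m \<rho>p * D)))" for k
  proof -
    let ?d = "\<rho>m * ((um - us k) + (um - s)) + \<rho>p * ((us k - up) + (s - up))"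
    have "g (us k) - g s = (s - us k) * ?d"
      by (simp add: g_def power2_eq_square algebra_simps)
    moreover have "2 * (min \<rho>m \<rho>p * D) =
      min \<rho>m \<rho>p * ((um - us k) + (um - s)) + min \<rho>m \<rho>p * ((us k - up) + (s - up))"
      by (simp add: D_def algebra_simps)
    moreover have "\<dots> \<le> ?d" using b[of k] s by (intro add_mono mult_right_mono) auto
    ultimately have "\<bar>us k - s\<bar> * (2 * (min \<rho>m \<rho>p * D)) \<le> \<bar>g (us k) - g s\<bar>"
      by (auto simp: abs_mult abs_minus_commute intro!: mult_left_mono)
    then show ?thesis using D pos by (simp add: field_simps)
  qed
  have "(\<lambda>k. us k - s) \<longlonglongrightarrow> 0"
  proof (rule Lim_null_comparison)
    show "eventually (\<lambda>k. norm (us k - s) \<le> \<bar>g (us k) - g s\<bar> * (1 / (2 * (min \<rho>m \<rho>p * D)))) sequentially"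
      using est by simp
    show "(\<lambda>k. \<bar>g (us k) - g s\<bar> * (1 / (2 * (min \<rho>m \<rho>p * D)))) \<longlonglongrightarrow> 0"
      by (intro tendsto_mult_left_zero tendsto_rabs_zero g0)
  qed
  then show "us \<longlonglongrightarrow> sigmaB B \<alpha> \<rho>m um \<rho>p up" 
    unfolding s_def by (rule LIM_zero_cancel)
qed

text \<open>Each speed differs from the middle velocity by a mass flux divided by a - \<rho>m or a -
  \<rho>p. Multiplication by a therefore leaves, in the limit, the two mass fluxes \<rho>p (\<sigma>
  - up) and \<rho>m (um - \<sigma>) into the front; the signs of the corrections give the order of
  the speeds.\<close>

lemma shock_speeds_tendsto:
  fixes a us :: "nat \<Rightarrow> real" and um up :: real
  assumes top: "filterlim a at_top sequentially" and a: "\<And>k. \<rho>m < a k" "\<And>k. \<rho>p < a k"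
    and us: "us \<longlonglongrightarrow> \<sigma>"
  defines "s1 \<equiv> \<lambda>k. (a k * us k - \<rho>m * um) / (a k - \<rho>m)"
    and "s2 \<equiv> \<lambda>k. (\<rho>p * up - a k * us k) / (\<rho>p - a k)"
  shows "s1 \<longlonglongrightarrow> \<sigma>" "s2 \<longlonglongrightarrow> \<sigma>"
    and "(\<lambda>k. a k * (s2 k - s1 k)) \<longlonglongrightarrow> \<sigma> * (\<rho>p - \<rho>m) - (\<rho>p * up - \<rho>m * um)"
    and "\<And>k. 0 \<le> \<rho>m \<Longrightarrow> 0 \<le> \<rho>p \<Longrightarrow> us k \<le> um \<Longrightarrow> up \<le> us k \<Longrightarrow> s1 k \<le> s2 k"
proof -
  have inv: "(\<lambda>k. 1 / (a k - b)) \<longlonglongrightarrow> 0" for b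
    by (intro real_tendsto_divide_at_top[OF tendsto_const]
        filterlim_tendsto_add_at_top[OF tendsto_const[of "-b"] top, simplified])
  have s1: "s1 k = us k - \<rho>m * (um - us k) * (1 / (a k - \<rho>m))" for k
    using a[of k] by (simp add: s1_def field_simps)
  have s2: "s2 k = us k + \<rho>p * (us k - up) * (1 / (a k - \<rho>p))" for k
    using a[of k] by (simp add: s2_def field_simps)
  have "(\<lambda>k. us k - \<rho>m * (um - us k) * (1 / (a k - \<rho>m))) \<longlonglongrightarrow> \<sigma> - \<rho>m * (um - \<sigma>) * 0"
    by (intro tendsto_intros us inv)
  then show "s1 \<longlonglongrightarrow> \<sigma>" by (simp add: s1[abs_def])
  have "(\<lambda>k. us k + \<rho>p * (us k - up) * (1 / (a k - \<rho>p))) \<longlonglongrightarrow> \<sigma> + \<rho>p * (\<sigma> - up) * 0"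
    by (intro tendsto_intros us inv)
  then show "s2 \<longlonglongrightarrow> \<sigma>" by (simp add: s2[abs_def])
  \<comment> \<open>The factor \<open>a k\<close> is absorbed through a/(a - b) = 1 + b/(a - b),
    which removes the product of a divergent and a vanishing term.\<close>
  have eq: "a k * (s2 k - s1 k) = \<rho>p * (us k - up) * (1 + \<rho>p * (1 / (a k - \<rho>p)))
      + \<rho>m * (um - us k) * (1 + \<rho>m * (1 / (a k - \<rho>m)))" for k
  proof -
    have *: "a k * (1 / (a k - b)) = 1 + b * (1 / (a k - b))" if "b < a k" for b
      using that by (simp add: field_simps)
    have "a k * (s2 k - s1 k) = \<rho>p * (us k - up) * (a k * (1 / (a k - \<rho>p)))
        + \<rho>m * (um - us k) * (a k * (1 / (a k - \<rho>m)))"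
      unfolding s1 s2 by (simp add: algebra_simps)
    then show ?thesis unfolding *[OF a(1)] *[OF a(2)] .
  qed
  have "(\<lambda>k. a k * (s2 k - s1 k)) \<longlonglongrightarrow>
      \<rho>p * (\<sigma> - up) * (1 + \<rho>p * 0) + \<rho>m * (um - \<sigma>) * (1 + \<rho>m * 0)"
    unfolding eq by (intro tendsto_intros us inv)
  then show "(\<lambda>k. a k * (s2 k - s1 k)) \<longlonglongrightarrow> \<sigma> * (\<rho>p - \<rho>m) - (\<rho>p * up - \<rho>m * um)"
    by (simp add: algebra_simps)
  show "s1 k \<le> s2 k" if "0 \<le> \<rho>m" "0 \<le> \<rho>p" "us k \<le> um" "up \<le> us k" for k
  proof -
    have "0 \<le> \<rho>m * (um - us k) * (1 / (a k - \<rho>m))" "0 \<le> \<rho>p * (us k - up) * (1 / (a k - \<rho>p))"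
      using that a[of k] by auto
    then show ?thesis unfolding s1 s2 by linarith
  qed
qed

subsection \<open>Pairings of piecewise constant fields\<close>

lemma integrable_bounded_mult_compact_support:
  fixes g h :: "'a::euclidean_space \<Rightarrow> real"
  assumes "continuous_on UNIV h" "compact S" "\<And>p. p \<notin> S \<Longrightarrow> h p = 0"
    and g: "g \<in> borel_measurable borel" "\<And>p. \<bar>g p\<bar> \<le> C"
  shows "integrable lborel (\<lambda>p. g p * h p)"
proof -
  have "integrable lborel (\<lambda>p. indicator S p *\<^sub>R h p)"
    using assms by (intro borel_integrable_compact) (auto intro: continuous_on_subset)
  moreover have "(\<lambda>p. indicator S p *\<^sub>R h p) = h"
    using assms(3) by (force simp: indicator_def)
  ultimately have h: "integrable lborel h" by simp
  show ?thesis
  proof (rule Bochner_Integration.integrable_bound)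
    show "integrable lborel (\<lambda>p. C * h p)" using h by simp
    show "(\<lambda>p. g p * h p) \<in> borel_measurable lborel"
      using g(1) borel_measurable_integrable[OF h] by simp
    have "\<bar>g p\<bar> \<le> \<bar>C\<bar>" for p using g(2)[of p] by linarith
    then show "AE p in lborel. norm (g p * h p) \<le> norm (C * h p)"
      by (auto simp: abs_mult intro!: mult_right_mono)
  qed
qed

lemma integral_derivative_compact_support:
  fixes F f :: "real \<Rightarrow> real"
  assumes "\<And>x. (F has_real_derivative f x) (at x)" "continuous_on UNIV f"
    and "\<And>x. R < \<bar>x\<bar> \<Longrightarrow> F x = 0" "\<And>x. R < \<bar>x\<bar> \<Longrightarrow> f x = 0"
  shows "(\<integral>x. f x \<partial>lborel) = 0"
proof -
  \<comment> \<open>|R| + 1 is positive for either sign of R and lies strictly beyond the set where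
    F may be nonzero.\<close>
  have "(\<lambda>x. f x * indicator {- (\<bar>R\<bar> + 1)..\<bar>R\<bar> + 1} x) = f"
  proof
    fix x show "f x * indicator {- (\<bar>R\<bar> + 1)..\<bar>R\<bar> + 1} x = f x"
      using assms(4)[of x] by (cases "R < \<bar>x\<bar>") (auto simp: indicator_def)
  qed
  moreover have "(\<integral>x. f x * indicator {- (\<bar>R\<bar> + 1)..\<bar>R\<bar> + 1} x \<partial>lborel) = F (\<bar>R\<bar> + 1) - F (- (\<bar>R\<bar> + 1))"
    by (intro integral_FTC_Icc_real assms(1))
      (use assms(2) in \<open>auto simp: continuous_on_eq_continuous_at\<close>)
  moreover have "F (\<bar>R\<bar> + 1) = 0" "F (- (\<bar>R\<bar> + 1)) = 0" by (auto intro!: assms(3))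
  ultimately show ?thesis by simp
qed

text \<open>One profile serves both the density and the momentum. Coinciding speeds give back the
  step function, so that facts about slices apply to the limit as well.\<close>

definition two_shock_fun :: "real \<Rightarrow> real \<Rightarrow> real \<Rightarrow> real \<Rightarrow> real \<Rightarrow> real \<times> real \<Rightarrow> real" where
  "two_shock_fun s1 s2 l m r = (\<lambda>(x, t). if x < s1 * t then l else if x < s2 * t then m else r)"

lemma step_fun_eq_two_shock_fun: "step_fun \<sigma> l r = two_shock_fun \<sigma> \<sigma> l m r"
  by (auto simp: step_fun_def two_shock_fun_def)

lemma two_shock_fun_measurable [measurable]: "two_shock_fun s1 s2 l m r \<in> borel_measurable borel"
  unfolding two_shock_fun_def borel_prod[symmetric] by measurable

text \<open>Keeps of a test function what the pairings need, continuity and bounded support in t >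
  0, so that the same facts apply to its partial derivatives.\<close>

locale box_function =
  fixes R :: real and h :: "real \<times> real \<Rightarrow> real"
  assumes continuous: "continuous_on UNIV h"
    and R_pos: "0 < R"
    and support: "\<And>x t. h (x, t) \<noteq> 0 \<Longrightarrow> \<bar>x\<bar> \<le> R \<and> 0 < t \<and> t \<le> R"
begin

lemma h_eq_0: "R < \<bar>x\<bar> \<Longrightarrow> h (x, t) = 0" "t \<le> 0 \<Longrightarrow> h (x, t) = 0" "R < t \<Longrightarrow> h (x, t) = 0"
  using support[of x t] by force+

lemma continuous_compose [continuous_intros]:
  "continuous_on A f \<Longrightarrow> continuous_on A g \<Longrightarrow> continuous_on A (\<lambda>y. h (f y, g y))"
  by (rule continuous_on_compose2[OF continuous]) (auto intro!: continuous_intros)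

lemma isCont_slice: "isCont (\<lambda>x. h (x, t)) x"
  using continuous_compose[of UNIV "\<lambda>x. x" "\<lambda>_. t"] by (simp add: continuous_on_eq_continuous_at)

lemma measurable_h [measurable]: "h \<in> borel_measurable borel"
  by (rule borel_measurable_continuous_onI[OF continuous])

lemma bounded: obtains M where "0 \<le> M" "\<And>p. \<bar>h p\<bar> \<le> M"
proof -
  have "compact (h ` (cbox (-R, 0) (R, R)))"
    by (intro compact_continuous_image continuous_on_subset[OF continuous]) auto
  then obtain M where M: "\<And>p. p \<in> cbox (-R, 0) (R, R) \<Longrightarrow> \<bar>h p\<bar> \<le> M"
    using compact_imp_bounded by (force simp: bounded_iff)
  have "\<bar>h p\<bar> \<le> \<bar>M\<bar>" for p
  proof (cases "h p = 0")
    case False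
    then have "p \<in> cbox (-R, 0) (R, R)"
      using support[of "fst p" "snd p"] by (cases p) (auto simp: abs_le_iff)
    then have "\<bar>h p\<bar> \<le> M" by (rule M)
    then show ?thesis by simp
  qed simp
  then show thesis using that[of "\<bar>M\<bar>"] by auto
qed

text \<open>In the coordinates (t, y) with y = x - \<sigma> t the front is y = 0. The sheared
  support fits into a box widened by |\<sigma>| R; this licenses Fubini in the moving frame.\<close>

lemma integrable_shear:
  assumes "g \<in> borel_measurable borel" "\<And>p. \<bar>g p\<bar> \<le> C"
  shows "integrable (lborel \<Otimes>\<^sub>M lborel) (\<lambda>p. g p * h (snd p + \<sigma> * fst p, fst p))"
  unfolding lborel_prod
proof (rule integrable_bounded_mult_compact_support[where C = C])
  show "continuous_on UNIV (\<lambda>p. h (snd p + \<sigma> * fst p, fst p))"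
    by (intro continuous_intros)
  show "compact (cbox (0, - (R + \<bar>\<sigma>\<bar> * R)) (R, R + \<bar>\<sigma>\<bar> * R))" by simp
  fix p :: "real \<times> real" assume p: "p \<notin> cbox (0, - (R + \<bar>\<sigma>\<bar> * R)) (R, R + \<bar>\<sigma>\<bar> * R)"
  obtain t y where [simp]: "p = (t, y)" by (cases p)
  show "h (snd p + \<sigma> * fst p, fst p) = 0"
  proof (rule ccontr)
    assume "h (snd p + \<sigma> * fst p, fst p) \<noteq> 0"
    then have *: "\<bar>y + \<sigma> * t\<bar> \<le> R" "0 < t" "t \<le> R" using support by force+
    then have "\<bar>\<sigma> * t\<bar> \<le> \<bar>\<sigma>\<bar> * R" by (auto simp: abs_mult intro!: mult_left_mono)
    then have "\<bar>y\<bar> \<le> R + \<bar>\<sigma>\<bar> * R" using * by linarith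
    then show False using p * by auto
  qed
qed (use assms in auto)

lemma pairing_whole_line: "pairing f h = (\<integral>t. (\<integral>x. f (x, t) * h (x, t) \<partial>lborel) \<partial>lborel)"
  unfolding pairing_def set_lebesgue_integral_def
  by (intro Bochner_Integration.integral_cong) (auto simp: indicator_def h_eq_0)

lemma ray_integrable: "integrable lborel (\<lambda>t. t * h (\<sigma> * t, t))"
proof -
  have "integrable lborel (\<lambda>t. 1 * (t * h (\<sigma> * t, t)))"
    by (intro integrable_bounded_mult_compact_support[where S = "{0..R}" and C = 1])
      (auto intro!: continuous_intros simp: not_le h_eq_0(2,3))
  then show ?thesis by simp
qed

text \<open>The arc length factor of the ray cancels the denominator of the weight, and the
  vanishing of h for t \<le> 0 extends the integral to the whole line.\<close>

lemma singular_pairing_linear_weight: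
  "singular_pairing \<sigma> f (\<lambda>t. t / sqrt (1 + \<sigma>\<^sup>2) * c) h =
    pairing f h + c * (\<integral>t. t * h (\<sigma> * t, t) \<partial>lborel)"
proof -
  have "weighted_delta (\<lambda>t. t / sqrt (1 + \<sigma>\<^sup>2) * c) (\<lambda>t. \<sigma> * t) (\<lambda>t. t) {0..} h =
      (\<integral>t. c * (t * h (\<sigma> * t, t)) \<partial>lborel)"
    unfolding weighted_delta_def set_lebesgue_integral_def
  proof (intro Bochner_Integration.integral_cong refl)
    fix t :: real
    have "deriv (\<lambda>t. \<sigma> * t) t = \<sigma>" "deriv (\<lambda>t. t) t = 1"
      by (auto intro!: DERIV_imp_deriv derivative_eq_intros)
    moreover have "sqrt (1 + \<sigma>\<^sup>2) \<noteq> 0" by (smt (verit) real_sqrt_gt_zero zero_le_power2)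
    ultimately show "indicator {0..} t *\<^sub>R (t / sqrt (1 + \<sigma>\<^sup>2) * c * h (\<sigma> * t, t) *
        sqrt ((deriv (\<lambda>t. \<sigma> * t) t)\<^sup>2 + (deriv (\<lambda>t. t) t)\<^sup>2)) = c * (t * h (\<sigma> * t, t))"
      by (auto simp: indicator_def h_eq_0 add.commute)
  qed
  then show ?thesis by (simp add: singular_pairing_def)
qed

text \<open>Every constant piece contributes its value times an increment of an antiderivative.
  Nothing is lost outside [-L, L], since h vanishes there.\<close>

lemma slice_two_shock:
  assumes "s1 * t \<le> s2 * t" "R \<le> L" "\<bar>s1 * t\<bar> \<le> L" "\<bar>s2 * t\<bar> \<le> L"
    and F: "\<And>x. (F has_real_derivative h (x, t)) (at x)"
  shows "(\<integral>x. two_shock_fun s1 s2 l m r (x, t) * h (x, t) \<partial>lborel) =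
    l * (F (s1 * t) - F (- L)) + m * (F (s2 * t) - F (s1 * t)) + r * (F L - F (s2 * t))"
proof -
  have I: "has_bochner_integral lborel (\<lambda>x. h (x, t) * indicator {a..b} x) (F b - F a)" if "a \<le> b" for a b
    by (rule has_bochner_integral_FTC_Icc_real[OF that F isCont_slice])
  have "has_bochner_integral lborel
     (\<lambda>x. l * (h (x, t) * indicator {-L..s1 * t} x) + m * (h (x, t) * indicator {s1 * t..s2 * t} x) +
       r * (h (x, t) * indicator {s2 * t..L} x))
     (l * (F (s1 * t) - F (- L)) + m * (F (s2 * t) - F (s1 * t)) + r * (F L - F (s2 * t)))"
    using assms by (intro has_bochner_integral_add has_bochner_integral_mult_right I) linarith+
  then have "(\<integral>x. l * (h (x, t) * indicator {-L..s1 * t} x) + m * (h (x, t) * indicator {s1 * t..s2 * t} x) +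
       r * (h (x, t) * indicator {s2 * t..L} x) \<partial>lborel) =
     l * (F (s1 * t) - F (- L)) + m * (F (s2 * t) - F (s1 * t)) + r * (F L - F (s2 * t))"
    by (rule has_bochner_integral_integral_eq)
  moreover have "(\<integral>x. two_shock_fun s1 s2 l m r (x, t) * h (x, t) \<partial>lborel) =
    (\<integral>x. l * (h (x, t) * indicator {-L..s1 * t} x) + m * (h (x, t) * indicator {s1 * t..s2 * t} x) +
       r * (h (x, t) * indicator {s2 * t..L} x) \<partial>lborel)"
  \<comment> \<open>The closed intervals overlap at the shock positions, where the two integrands
    may differ; these at most two points are a null set.\<close>
  proof (rule integral_discrete_difference[where X = "{s1 * t, s2 * t}"])
    fix x assume "x \<notin> {s1 * t, s2 * t}"
    then show "two_shock_fun s1 s2 l m r (x, t) * h (x, t) =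
      l * (h (x, t) * indicator {-L..s1 * t} x) + m * (h (x, t) * indicator {s1 * t..s2 * t} x) +
       r * (h (x, t) * indicator {s2 * t..L} x)"
      using assms h_eq_0(1)[of x t] by (auto simp: two_shock_fun_def indicator_def)
  qed auto
  ultimately show ?thesis by simp
qed

lemma slice_antiderivative:
  obtains F where "\<And>x. (F has_real_derivative h (x, t)) (at x)"
proof -
  have "\<exists>F. \<forall>x::real. - \<infinity> < ereal x \<longrightarrow> ereal x < \<infinity> \<longrightarrow> (F has_vector_derivative h (x, t)) (at x)"
    by (rule einterval_antiderivative) (auto intro: isCont_slice)
  then obtain F where "\<And>x. (F has_real_derivative h (x, t)) (at x)"
    by (auto simp: has_real_derivative_iff_has_vector_derivative)
  then show thesis by (rule that)
qed

end

section \<open>Concentration limit of the pairings\<close>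

lemma MVT_le:
  fixes F f :: "real \<Rightarrow> real"
  assumes "\<And>x. (F has_real_derivative f x) (at x)" "a \<le> b"
  obtains z where "a \<le> z" "z \<le> b" "F b - F a = (b - a) * f z"
proof (cases "a = b")
  case False
  then show thesis using MVT2[of a b F f] assms that by (metis less_le)
qed (use that[of a] in simp)

text \<open>By the mean value theorem the middle piece is m (s2 - s1) t times a value of h between
  the shocks. This interval shrinks to \<sigma> t, so continuity of h gives the point mass.\<close>

lemma (in box_function) slice_two_shock_tendsto:
  fixes s1 s2 m :: "nat \<Rightarrow> real"
  assumes le: "\<And>k. s1 k \<le> s2 k" and s: "s1 \<longlonglongrightarrow> \<sigma>" "s2 \<longlonglongrightarrow> \<sigma>"
    and m: "(\<lambda>k. m k * (s2 k - s1 k)) \<longlonglongrightarrow> c" and t: "0 < t"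
  shows "(\<lambda>k. \<integral>x. two_shock_fun (s1 k) (s2 k) l (m k) r (x, t) * h (x, t) \<partial>lborel) \<longlonglongrightarrow>
    (\<integral>x. step_fun \<sigma> l r (x, t) * h (x, t) \<partial>lborel) + c * (t * h (\<sigma> * t, t))"
proof -
  obtain F where F: "\<And>x. (F has_real_derivative h (x, t)) (at x)"
    using slice_antiderivative[of t] by blast
  obtain S1 S2 where S: "\<And>k. \<bar>s1 k\<bar> \<le> S1" "\<And>k. \<bar>s2 k\<bar> \<le> S2"
    using s[THEN convergentI, THEN convergent_imp_Bseq] by (auto simp: Bseq_def)
  \<comment> \<open>One cut-off beyond the support and all shock positions of the sequence, so that
    \<open>F L\<close> and \<open>F (- L)\<close> are constants in the limit.\<close>
  define L where "L = R + (S1 + S2 + \<bar>\<sigma>\<bar>) * t"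
  have "0 \<le> S1" "0 \<le> S2" using S[of 0] by linarith+
  then have L: "R \<le> L" "\<And>k. \<bar>s1 k * t\<bar> \<le> L" "\<And>k. \<bar>s2 k * t\<bar> \<le> L" "\<bar>\<sigma> * t\<bar> \<le> L"
    unfolding L_def abs_mult using S t R_pos
    by (auto intro!: add_increasing mult_right_mono simp: add_increasing add_increasing2)
  have eq: "(\<integral>x. two_shock_fun (s1 k) (s2 k) l (m k) r (x, t) * h (x, t) \<partial>lborel) =
    l * (F (s1 k * t) - F (- L)) + m k * (F (s2 k * t) - F (s1 k * t)) + r * (F L - F (s2 k * t))" for k
    using le t L by (intro slice_two_shock F) auto
  \<comment> \<open>With coinciding shocks the middle value is arbitrary; 0 is chosen.\<close>
  have eq0: "(\<integral>x. step_fun \<sigma> l r (x, t) * h (x, t) \<partial>lborel) =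
    l * (F (\<sigma> * t) - F (- L)) + 0 * (F (\<sigma> * t) - F (\<sigma> * t)) + r * (F L - F (\<sigma> * t))"
    unfolding step_fun_eq_two_shock_fun[of _ _ _ 0] using L by (intro slice_two_shock F) auto
  have Fs: "(\<lambda>k. F (s k * t)) \<longlonglongrightarrow> F (\<sigma> * t)" if "s \<longlonglongrightarrow> \<sigma>" for s
    by (rule isCont_tendsto_compose[OF DERIV_isCont[OF F]]) (intro tendsto_intros that)
  have "\<exists>z. s1 k * t \<le> z \<and> z \<le> s2 k * t \<and> F (s2 k * t) - F (s1 k * t) = (s2 k * t - s1 k * t) * h (z, t)" for k
    using MVT_le[OF F, of "s1 k * t" "s2 k * t"] le[of k] t by (metis mult_right_mono less_imp_le)
  then obtain z where z: "\<And>k. s1 k * t \<le> z k" "\<And>k. z k \<le> s2 k * t"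
    "\<And>k. F (s2 k * t) - F (s1 k * t) = (s2 k * t - s1 k * t) * h (z k, t)" by metis
  have "z \<longlonglongrightarrow> \<sigma> * t"
    by (rule tendsto_sandwich[of "\<lambda>k. s1 k * t" _ _ "\<lambda>k. s2 k * t"])
      (use z s in \<open>auto intro!: tendsto_intros\<close>)
  then have "(\<lambda>k. h (z k, t)) \<longlonglongrightarrow> h (\<sigma> * t, t)"
    by (intro continuous_on_tendsto_compose[OF continuous] tendsto_intros) auto
  then have "(\<lambda>k. m k * (s2 k - s1 k) * (t * h (z k, t))) \<longlonglongrightarrow> c * (t * h (\<sigma> * t, t))"
    by (intro tendsto_intros m)
  moreover have "m k * (F (s2 k * t) - F (s1 k * t)) = m k * (s2 k - s1 k) * (t * h (z k, t))" for k
    unfolding z(3) by (simp add: algebra_simps)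
  ultimately have "(\<lambda>k. m k * (F (s2 k * t) - F (s1 k * t))) \<longlonglongrightarrow> c * (t * h (\<sigma> * t, t))"
    by (simp only:)
  note lim_m = this
  have "(\<lambda>k. l * (F (s1 k * t) - F (- L)) + m k * (F (s2 k * t) - F (s1 k * t)) + r * (F L - F (s2 k * t)))
    \<longlonglongrightarrow> l * (F (\<sigma> * t) - F (- L)) + c * (t * h (\<sigma> * t, t)) + r * (F L - F (\<sigma> * t))"
    by (intro tendsto_add[OF tendsto_add[OF _ lim_m]] tendsto_intros Fs s)
  then show ?thesis unfolding eq eq0 by (simp add: algebra_simps)
qed

text \<open>The majorant for dominated convergence in t. The middle value enters only through its
  product with s2 - s1, because the middle density itself diverges.\<close>

lemma (in box_function) slice_two_shock_bound:
  assumes "s1 \<le> s2" "\<bar>s1\<bar> \<le> S" "\<bar>s2\<bar> \<le> S" "\<bar>m * (s2 - s1)\<bar> \<le> C" and M: "\<And>p. \<bar>h p\<bar> \<le> M"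
  shows "\<bar>\<integral>x. two_shock_fun s1 s2 l m r (x, t) * h (x, t) \<partial>lborel\<bar>
    \<le> ((\<bar>l\<bar> + \<bar>r\<bar>) * (2 * (R + S * R) * M) + C * R * M) * indicator {0..R} t"
proof (cases "0 < t \<and> t \<le> R")
  case False
  then have "h (x, t) = 0" for x using h_eq_0 by force
  moreover have "0 \<le> M" "0 \<le> S" "0 \<le> C" using assms(2,4) M[of 0] by linarith+
  ultimately show ?thesis using R_pos by (auto simp: indicator_def)
next
  case t: True
  obtain F where F: "\<And>x. (F has_real_derivative h (x, t)) (at x)"
    using slice_antiderivative[of t] by blast
  have "0 \<le> M" "0 \<le> S" "0 \<le> C" using assms(2,4) M[of 0] by linarith+
  define L where "L = R + S * R"
  have st: "\<bar>s * t\<bar> \<le> S * R" if "\<bar>s\<bar> \<le> S" for s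
    unfolding abs_mult using that t by (intro mult_mono) auto
  have L: "\<bar>s1 * t\<bar> \<le> L" "\<bar>s2 * t\<bar> \<le> L" "R \<le> L"
    using st[OF assms(2)] st[OF assms(3)] R_pos \<open>0 \<le> S\<close> by (auto simp: L_def)
  have F_le: "\<bar>F b - F a\<bar> \<le> (b - a) * M" if "a \<le> b" for a b
    using MVT_le[OF F that] M that by (metis abs_mult abs_of_nonneg diff_ge_0_iff_ge mult_left_mono)
  have F_le': "\<bar>F b - F a\<bar> \<le> 2 * L * M" if "a \<le> b" "- L \<le> a" "b \<le> L" for a b
    using F_le[OF that(1)] mult_right_mono[OF _ \<open>0 \<le> M\<close>, of "b - a" "2 * L"] that by linarith
  have "\<bar>m * (F (s2 * t) - F (s1 * t))\<bar> \<le> \<bar>m\<bar> * ((s2 * t - s1 * t) * M)"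
    unfolding abs_mult using assms t by (intro mult_left_mono F_le) auto
  also have "\<dots> = \<bar>m * (s2 - s1)\<bar> * t * M" using assms(1)
    unfolding abs_mult by (simp add: left_diff_distrib[symmetric])
  also have "\<dots> \<le> C * R * M" using assms t \<open>0 \<le> M\<close> by (intro mult_mono) auto
  finally have "\<bar>m * (F (s2 * t) - F (s1 * t))\<bar> \<le> C * R * M" .
  moreover have "\<bar>l * (F (s1 * t) - F (- L))\<bar> \<le> \<bar>l\<bar> * (2 * L * M)" "\<bar>r * (F L - F (s2 * t))\<bar> \<le> \<bar>r\<bar> * (2 * L * M)"
    unfolding abs_mult using L by (intro mult_left_mono F_le'; force)+
  moreover have "(\<integral>x. two_shock_fun s1 s2 l m r (x, t) * h (x, t) \<partial>lborel) =
    l * (F (s1 * t) - F (- L)) + m * (F (s2 * t) - F (s1 * t)) + r * (F L - F (s2 * t))"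
    using assms t L by (intro slice_two_shock F) auto
  ultimately have "\<bar>\<integral>x. two_shock_fun s1 s2 l m r (x, t) * h (x, t) \<partial>lborel\<bar>
      \<le> \<bar>l\<bar> * (2 * L * M) + C * R * M + \<bar>r\<bar> * (2 * L * M)" by linarith
  then show ?thesis using t by (simp add: L_def algebra_simps)
qed

text \<open>Dominated convergence in t, applied to the slice limits. The fields are prescribed off
  the shock lines only, which leaves at most two points free on each slice.\<close>

lemma (in box_function) pairing_two_shock_tendsto:
  fixes s1 s2 m :: "nat \<Rightarrow> real"
  assumes le: "\<And>k. s1 k \<le> s2 k" and s: "s1 \<longlonglongrightarrow> \<sigma>" "s2 \<longlonglongrightarrow> \<sigma>"
    and m: "(\<lambda>k. m k * (s2 k - s1 k)) \<longlonglongrightarrow> c"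
    and f: "\<And>k x t. 0 < t \<Longrightarrow> x \<noteq> s1 k * t \<Longrightarrow> x \<noteq> s2 k * t \<Longrightarrow>
      f k (x, t) = two_shock_fun (s1 k) (s2 k) l (m k) r (x, t)"
  shows "(\<lambda>k. pairing (f k) h) \<longlonglongrightarrow>
    pairing (step_fun \<sigma> l r) h + c * (\<integral>t. t * h (\<sigma> * t, t) \<partial>lborel)"
proof -
  define I where "I k t = (\<integral>x. two_shock_fun (s1 k) (s2 k) l (m k) r (x, t) * h (x, t) \<partial>lborel)" for k t
  define J where "J t = (\<integral>x. step_fun \<sigma> l r (x, t) * h (x, t) \<partial>lborel)" for t
  obtain M where M: "\<And>p. \<bar>h p\<bar> \<le> M" using bounded by blast
  obtain S1 S2 C where S: "\<And>k. \<bar>s1 k\<bar> \<le> S1" "\<And>k. \<bar>s2 k\<bar> \<le> S2" "\<And>k. \<bar>m k * (s2 k - s1 k)\<bar> \<le> C"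
    using s[THEN convergentI, THEN convergent_imp_Bseq] m[THEN convergentI, THEN convergent_imp_Bseq]
    by (auto simp: Bseq_def)
  have slice_meas: "(\<lambda>t. \<integral>x. two_shock_fun a b l d r (x, t) * h (x, t) \<partial>lborel) \<in> borel_measurable lborel" for a b d
  proof -
    \<comment> \<open>The coordinates are swapped because the outer variable t must come first in
      the product measure.\<close>
    have "(\<lambda>p. two_shock_fun a b l d r (snd p, fst p) * h (snd p, fst p)) \<in> borel_measurable (lborel \<Otimes>\<^sub>M lborel)"
    proof -
      have "(\<lambda>p. (snd p, fst p)) \<in> borel_measurable (borel :: (real \<times> real) measure)"
        by (intro borel_measurable_continuous_onI continuous_intros)
      from measurable_compose[OF this two_shock_fun_measurable] measurable_compose[OF this measurable_h]
      show ?thesis unfolding lborel_prod measurable_lborel2 by (rule borel_measurable_times)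
    qed
    then show ?thesis
      by (intro lborel.borel_measurable_lebesgue_integral) (simp add: case_prod_beta')
  qed
  have G_meas: "(\<lambda>t. J t + c * (t * h (\<sigma> * t, t))) \<in> borel_measurable lborel"
    using slice_meas[of \<sigma> \<sigma> 0] borel_measurable_integrable[OF ray_integrable[of \<sigma>]]
    unfolding J_def step_fun_eq_two_shock_fun[of _ _ _ 0] by (intro borel_measurable_add) auto
  have lim: "(\<lambda>k. I k t) \<longlonglongrightarrow> J t + c * (t * h (\<sigma> * t, t))" for t
  proof (cases "0 < t")
    case True then show ?thesis unfolding I_def J_def by (rule slice_two_shock_tendsto[OF le s m])
  qed (simp add: I_def J_def h_eq_0)
  let ?w = "\<lambda>t. ((\<bar>l\<bar> + \<bar>r\<bar>) * (2 * (R + max S1 S2 * R) * M) + C * R * M) * indicator {0..R} t"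
  have bound: "AE t in lborel. norm (I k t) \<le> ?w t" for k
    unfolding real_norm_def I_def
    by (intro always_eventually allI slice_two_shock_bound le M S(3)) (use S in \<open>auto simp: le_max_iff_disj\<close>)
  have w: "integrable lborel ?w" by (intro integrable_mult_right integrable_real_indicator) (use R_pos in auto)
  have I_meas: "I k \<in> borel_measurable lborel" for k unfolding I_def by (rule slice_meas)
  note dct = G_meas I_meas w always_eventually[OF allI, OF lim] bound
  \<comment> \<open>Dominated convergence yields integrability of the whole limit; subtracting the
    ray term gives that of J, so the limit integral can be split.\<close>
  have "integrable lborel (\<lambda>t. J t + c * (t * h (\<sigma> * t, t)))"
    by (rule integrable_dominated_convergence[OF dct])
  from Bochner_Integration.integrable_diff[OF this integrable_mult_right[OF ray_integrable[of \<sigma>], of c]]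
  have "integrable lborel J" by simp
  then have "(\<integral>t. J t + c * (t * h (\<sigma> * t, t)) \<partial>lborel) =
      (\<integral>t. J t \<partial>lborel) + c * (\<integral>t. t * h (\<sigma> * t, t) \<partial>lborel)"
    using ray_integrable[of \<sigma>] by simp
  moreover have "(\<lambda>k. \<integral>t. I k t \<partial>lborel) \<longlonglongrightarrow> (\<integral>t. J t + c * (t * h (\<sigma> * t, t)) \<partial>lborel)"
    by (rule integral_dominated_convergence[OF dct])
  moreover have "pairing (f k) h = (\<integral>t. I k t \<partial>lborel)" for k
    unfolding pairing_whole_line I_def
  proof (rule Bochner_Integration.integral_cong[OF refl])
    fix t
    show "(\<integral>x. f k (x, t) * h (x, t) \<partial>lborel) =
        (\<integral>x. two_shock_fun (s1 k) (s2 k) l (m k) r (x, t) * h (x, t) \<partial>lborel)"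
    proof (cases "0 < t")
      case True
      then show ?thesis
        by (intro integral_discrete_difference[where X = "{s1 k * t, s2 k * t}"]) (auto simp: f)
    qed (simp add: h_eq_0)
  qed
  ultimately show ?thesis unfolding pairing_whole_line J_def by simp
qed

section \<open>Derivatives of test functions and the weak equations on the ray\<close>

lemma test_function_derivatives:
  assumes "test_function \<psi>"
  obtains R where "box_function R \<psi>" "box_function R (partial_x \<psi>)" "box_function R (partial_t \<psi>)"
    and "\<And>y \<sigma> t. ((\<lambda>t. \<psi> (y + \<sigma> * t, t)) has_real_derivative
          partial_t \<psi> (y + \<sigma> * t, t) + \<sigma> * partial_x \<psi> (y + \<sigma> * t, t)) (at t)"
    and "\<And>x t. ((\<lambda>x. \<psi> (x, t)) has_real_derivative partial_x \<psi> (x, t)) (at x)"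
proof -
  define S where "S = closure {p. \<psi> p \<noteq> 0}"
  let ?D = "\<lambda>p. frechet_derivative \<psi> (at p)"
  have Ck: "\<And>k. C_k k \<psi>" and S: "compact S" "S \<subseteq> UNIV \<times> {0<..}"
    using assms by (auto simp: test_function_def S_def)
  have "\<psi> differentiable (at p)" for p
    using Ck[of "Suc 0"] unfolding C_k.simps by blast
  then have D: "(\<psi> has_derivative ?D p) (at p)" for p
    by (simp only: frechet_derivative_works)
  have contD: "continuous_on UNIV (\<lambda>p. ?D p v)" for v
    using Ck[of "Suc 0"] unfolding C_k.simps by blast
  have linear: "?D p (a, b) = a * ?D p (1, 0) + b * ?D p (0, 1)" for p a b
  proof -
    have "linear (?D p)" using D has_derivative_linear by blast
    then have "?D p (a *\<^sub>R (1, 0) + b *\<^sub>R (0, 1)) = a *\<^sub>R ?D p (1, 0) + b *\<^sub>R ?D p (0, 1)"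
      by (simp only: linear_add linear_scale)
    then show ?thesis by simp
  qed
  \<comment> \<open>One chain rule along an arbitrary line yields both partial derivatives and the
    derivative parallel to the front.\<close>
  have curve: "((\<lambda>t. \<psi> (y + a * t, z + b * t)) has_real_derivative
      a * ?D (y + a * t, z + b * t) (1, 0) + b * ?D (y + a * t, z + b * t) (0, 1)) (at t)" for y z a b t
  proof -
    have "((\<lambda>t. (y + a * t, z + b * t)) has_derivative (\<lambda>d. (a * d, b * d))) (at t)"
      by (auto intro!: derivative_eq_intros)
    from has_derivative_compose[OF this D]
    have "((\<lambda>t. \<psi> (y + a * t, z + b * t)) has_derivative
      (\<lambda>d. ?D (y + a * t, z + b * t) (a * d, b * d))) (at t)" .
    moreover have "?D (y + a * t, z + b * t) (a * d, b * d) =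
      (a * ?D (y + a * t, z + b * t) (1, 0) + b * ?D (y + a * t, z + b * t) (0, 1)) * d" for d
      unfolding linear[of _ "a * d" "b * d"] by (simp add: algebra_simps)
    ultimately show ?thesis unfolding has_field_derivative_def by (simp only:)
  qed
  have px: "partial_x \<psi> = (\<lambda>p. ?D p (1, 0))"
  proof
    fix p :: "real \<times> real"
    show "partial_x \<psi> p = ?D p (1, 0)"
      using DERIV_imp_deriv[OF curve[of 0 1 "snd p" 0 "fst p"]] by (simp add: partial_x_def case_prod_beta)
  qed
  have pt: "partial_t \<psi> = (\<lambda>p. ?D p (0, 1))"
  proof
    fix p :: "real \<times> real"
    show "partial_t \<psi> p = ?D p (0, 1)"
      using DERIV_imp_deriv[OF curve[of "fst p" 0 0 1 "snd p"]] by (simp add: partial_t_def case_prod_beta)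
  qed
  have off_S: "\<psi> p = 0" if "p \<notin> S" for p
    using that closure_subset[of "{p. \<psi> p \<noteq> 0}"] unfolding S_def by blast
  have "open (- S)" unfolding S_def by (intro open_Compl closed_closure)
  \<comment> \<open>The complement of the closed support is open, so the function is locally zero
    there and its derivative vanishes too.\<close>
  have zero: "\<psi> p = 0" "?D p = (\<lambda>_. 0)" if "p \<notin> S" for p
  proof -
    show "\<psi> p = 0" using that by (rule off_S)
    have "((\<lambda>_. 0) has_derivative (\<lambda>_. 0)) (at p)" by simp
    then have "(\<psi> has_derivative (\<lambda>_. 0)) (at p)"
      by (rule has_derivative_transform_within_open[of _ _ _ _ "- S"])
        (use that \<open>open (- S)\<close> in \<open>simp_all add: off_S\<close>)
    then show "?D p = (\<lambda>_. 0)" using D has_derivative_unique by blast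
  qed
  obtain R0 where R0: "\<And>p. p \<in> S \<Longrightarrow> norm p \<le> R0"
    using compact_imp_bounded[OF S(1)] by (auto simp: bounded_iff)
  define R where "R = \<bar>R0\<bar> + 1"
  have box: "box_function R g" if "continuous_on UNIV g" "\<And>p. p \<notin> S \<Longrightarrow> g p = 0" for g
  proof
    fix x t :: real assume "g (x, t) \<noteq> 0"
    then have "(x, t) \<in> S" using that by blast
    then show "\<bar>x\<bar> \<le> R \<and> 0 < t \<and> t \<le> R"
      using S(2) R0[of "(x, t)"] norm_fst_le[of x t] norm_snd_le[of t x] by (auto simp: R_def)
  qed (use that in \<open>auto simp: R_def\<close>)
  show thesis
  proof (rule that[of R])
    show "box_function R \<psi>" using Ck[of 0] zero(1) by (intro box) simp_all
    show "box_function R (partial_x \<psi>)" "box_function R (partial_t \<psi>)"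
      unfolding px pt by (rule box[OF contD], simp add: zero(2))+
    show "((\<lambda>t. \<psi> (y + \<sigma> * t, t)) has_real_derivative
          partial_t \<psi> (y + \<sigma> * t, t) + \<sigma> * partial_x \<psi> (y + \<sigma> * t, t)) (at t)" for y \<sigma> t
      using curve[of y \<sigma> 0 1 t] by (simp add: px pt add.commute)
    show "((\<lambda>x. \<psi> (x, t)) has_real_derivative partial_x \<psi> (x, t)) (at x)" for x t
      using curve[of 0 1 t 0 x] by (simp add: px)
  qed
qed

text \<open>On a slice h itself is the antiderivative and vanishes at the cut-offs, so only the jump
  across the ray survives.\<close>

lemma (in box_function) pairing_partial_x:
  assumes bx: "box_function R (partial_x h)"
    and dx: "\<And>x t. ((\<lambda>x. h (x, t)) has_real_derivative partial_x h (x, t)) (at x)"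
  shows "pairing (step_fun \<sigma> l r) (partial_x h) = (l - r) * (\<integral>t. h (\<sigma> * t, t) \<partial>lborel)"
proof -
  interpret x: box_function R "partial_x h" by (rule bx)
  have "(\<integral>x. step_fun \<sigma> l r (x, t) * partial_x h (x, t) \<partial>lborel) = (l - r) * h (\<sigma> * t, t)" for t
  proof -
    define L where "L = R + \<bar>\<sigma> * t\<bar> + 1"
    have "(\<integral>x. step_fun \<sigma> l r (x, t) * partial_x h (x, t) \<partial>lborel) =
      l * (h (\<sigma> * t, t) - h (-L, t)) + 0 * (h (\<sigma> * t, t) - h (\<sigma> * t, t)) + r * (h (L, t) - h (\<sigma> * t, t))"
      unfolding step_fun_eq_two_shock_fun[of _ _ _ 0] using R_pos
      by (intro x.slice_two_shock dx) (auto simp: L_def)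
    moreover have "h (L, t) = 0" "h (-L, t) = 0" using R_pos by (auto intro!: h_eq_0(1) simp: L_def)
    ultimately show ?thesis by (simp add: algebra_simps)
  qed
  then show ?thesis unfolding x.pairing_whole_line by simp
qed

text \<open>
  In coordinates moving with the front the step function does not depend on \<open>t\<close>, and the
  derivative along the front integrates to zero in \<open>t\<close>.
\<close>

lemma (in box_function) pairing_partial_t:
  assumes bx: "box_function R (partial_x h)" and bt: "box_function R (partial_t h)"
    and ds: "\<And>y \<sigma> t. ((\<lambda>t. h (y + \<sigma> * t, t)) has_real_derivative
          partial_t h (y + \<sigma> * t, t) + \<sigma> * partial_x h (y + \<sigma> * t, t)) (at t)"
  shows "pairing (step_fun \<sigma> l r) (partial_t h) = - \<sigma> * pairing (step_fun \<sigma> l r) (partial_x h)"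
proof -
  interpret x: box_function R "partial_x h" by (rule bx)
  interpret t: box_function R "partial_t h" by (rule bt)
  \<comment> \<open>The step function in the moving coordinate y = x - \<sigma> t.\<close>
  define s0 :: "real \<Rightarrow> real" where "s0 y = (if y < 0 then l else r)" for y
  have s0: "(\<lambda>p. s0 (snd p)) \<in> borel_measurable (borel :: (real \<times> real) measure)" "\<bar>s0 (snd p)\<bar> \<le> \<bar>l\<bar> + \<bar>r\<bar>" for p :: "real \<times> real"
  proof -
    have "s0 \<in> borel_measurable borel" unfolding s0_def by measurable
    then show "(\<lambda>p. s0 (snd p)) \<in> borel_measurable (borel :: (real \<times> real) measure)"
      by (rule measurable_compose[rotated]) (intro borel_measurable_continuous_onI continuous_intros)
  qed (auto simp: s0_def)
  have shift: "(\<integral>x. step_fun \<sigma> l r (x, t) * g (x, t) \<partial>lborel) = (\<integral>y. s0 y * g (y + \<sigma> * t, t) \<partial>lborel)"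
    for g :: "real \<times> real \<Rightarrow> real" and t
    by (subst lborel_integral_real_affine[where c = 1 and t = "\<sigma> * t"])
      (auto simp: s0_def step_fun_def add.commute intro!: Bochner_Integration.integral_cong)
  note ix = x.integrable_shear[OF s0, of \<sigma>] and it = t.integrable_shear[OF s0, of \<sigma>]
  have swap: "(\<integral>t. (\<integral>x. step_fun \<sigma> l r (x, t) * g (x, t) \<partial>lborel) \<partial>lborel) =
      (\<integral>y. s0 y * (\<integral>t. g (y + \<sigma> * t, t) \<partial>lborel) \<partial>lborel)"
    if "box_function R g" for g
  proof -
    interpret g: box_function R g by (rule that)
    have "integrable (lborel \<Otimes>\<^sub>M lborel) (\<lambda>(t, y). s0 y * g (y + \<sigma> * t, t))"
      using g.integrable_shear[OF s0, of \<sigma>] by (simp add: case_prod_beta')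
    then have "(\<integral>t. (\<integral>y. s0 y * g (y + \<sigma> * t, t) \<partial>lborel) \<partial>lborel) =
        (\<integral>y. (\<integral>t. s0 y * g (y + \<sigma> * t, t) \<partial>lborel) \<partial>lborel)"
      by (rule lborel_pair.Fubini_integral[symmetric])
    then show ?thesis unfolding shift[of _ g] by (simp only: integral_mult_right_zero)
  qed
  \<comment> \<open>The derivative of h in the direction (\<sigma>, 1). After Fubini its integral
    over t vanishes for every y.\<close>
  let ?g = "\<lambda>p. partial_t h p + \<sigma> * partial_x h p"
  have g: "box_function R ?g"
  proof
    show "continuous_on UNIV ?g"
      by (intro continuous_on_add continuous_on_mult_left x.continuous t.continuous)
    fix x t assume "?g (x, t) \<noteq> 0"
    then have "partial_x h (x, t) \<noteq> 0 \<or> partial_t h (x, t) \<noteq> 0" by auto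
    then show "\<bar>x\<bar> \<le> R \<and> 0 < t \<and> t \<le> R" using x.support t.support by blast
  qed (rule R_pos)
  interpret g: box_function R ?g by (rule g)
  have "(\<integral>t. ?g (y + \<sigma> * t, t) \<partial>lborel) = 0" for y
  proof (rule integral_derivative_compact_support[where F = "\<lambda>t. h (y + \<sigma> * t, t)" and R = R])
    show "continuous_on UNIV (\<lambda>t. ?g (y + \<sigma> * t, t))"
      by (rule g.continuous_compose) (intro continuous_intros)+
    show "h (y + \<sigma> * t, t) = 0" "?g (y + \<sigma> * t, t) = 0" if "R < \<bar>t\<bar>" for t
      using that h_eq_0(2,3)[of t] g.h_eq_0(2,3)[of t] by (cases "t \<le> 0"; simp)+
  qed (rule ds)
  then have "pairing (step_fun \<sigma> l r) ?g = 0"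
    unfolding g.pairing_whole_line swap[OF g] by simp
  \<comment> \<open>Additivity of the iterated integral needs integrability twice: of each slice in
    y, and of the inner integrals in t.\<close>
  moreover have "pairing (step_fun \<sigma> l r) ?g =
      pairing (step_fun \<sigma> l r) (partial_t h) + \<sigma> * pairing (step_fun \<sigma> l r) (partial_x h)"
  proof -
    have "(\<integral>x. step_fun \<sigma> l r (x, t) * ?g (x, t) \<partial>lborel) =
      (\<integral>y. s0 y * partial_t h (y + \<sigma> * t, t) \<partial>lborel) + \<sigma> * (\<integral>y. s0 y * partial_x h (y + \<sigma> * t, t) \<partial>lborel)" for t
    proof -
      have "integrable lborel (\<lambda>y. s0 y * q (y + \<sigma> * t, t))" if q: "box_function R q" for q
      proof -
        interpret q: box_function R q by (rule q)
        show ?thesis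
          by (intro integrable_bounded_mult_compact_support[where S = "{-(R + \<bar>\<sigma> * t\<bar>)..R + \<bar>\<sigma> * t\<bar>}" and C = "\<bar>l\<bar> + \<bar>r\<bar>"])
            (auto simp: s0_def intro!: continuous_intros q.continuous_compose q.h_eq_0(1))
      qed
      from this[OF bx] this[OF bt] have "(\<integral>y. s0 y * partial_t h (y + \<sigma> * t, t) + \<sigma> * (s0 y * partial_x h (y + \<sigma> * t, t)) \<partial>lborel) =
        (\<integral>y. s0 y * partial_t h (y + \<sigma> * t, t) \<partial>lborel) + \<sigma> * (\<integral>y. s0 y * partial_x h (y + \<sigma> * t, t) \<partial>lborel)"
        by simp
      moreover have "s0 y * ?g (y + \<sigma> * t, t) =
          s0 y * partial_t h (y + \<sigma> * t, t) + \<sigma> * (s0 y * partial_x h (y + \<sigma> * t, t))" for y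
        by (simp add: distrib_left mult.left_commute)
      ultimately show ?thesis unfolding shift[of t ?g] by (simp only:)
    qed
    then show ?thesis
      using lborel_pair.integrable_fst'[OF ix] lborel_pair.integrable_fst'[OF it]
      unfolding g.pairing_whole_line x.pairing_whole_line t.pairing_whole_line
        shift[of _ "partial_x h"] shift[of _ "partial_t h"] by simp
  qed
  ultimately show ?thesis by simp
qed

text \<open>The derivative of t h(\<sigma> t, t) along the ray is the sum of all three integrands,
  and its integral vanishes by compact support.\<close>

lemma (in box_function) ray_integral_by_parts:
  assumes bx: "box_function R (partial_x h)" and bt: "box_function R (partial_t h)"
    and ds: "\<And>y \<sigma> t. ((\<lambda>t. h (y + \<sigma> * t, t)) has_real_derivative
          partial_t h (y + \<sigma> * t, t) + \<sigma> * partial_x h (y + \<sigma> * t, t)) (at t)"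
  shows "(\<integral>t. t * partial_t h (\<sigma> * t, t) \<partial>lborel) + \<sigma> * (\<integral>t. t * partial_x h (\<sigma> * t, t) \<partial>lborel) =
    - (\<integral>t. h (\<sigma> * t, t) \<partial>lborel)"
proof -
  interpret x: box_function R "partial_x h" by (rule bx)
  interpret t: box_function R "partial_t h" by (rule bt)
  have "integrable lborel (\<lambda>t. 1 * h (\<sigma> * t, t))"
    by (intro integrable_bounded_mult_compact_support[where S = "{0..R}" and C = 1])
      (auto intro!: continuous_intros simp: not_le h_eq_0(2,3))
  then have i: "integrable lborel (\<lambda>t. h (\<sigma> * t, t))" by simp
  have "(\<integral>t. h (\<sigma> * t, t) + (t * partial_t h (\<sigma> * t, t) + \<sigma> * (t * partial_x h (\<sigma> * t, t))) \<partial>lborel) = 0"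
  proof (rule integral_derivative_compact_support[where F = "\<lambda>t. t * h (\<sigma> * t, t)" and R = R])
    fix t
    show "((\<lambda>t. t * h (\<sigma> * t, t)) has_real_derivative
        h (\<sigma> * t, t) + (t * partial_t h (\<sigma> * t, t) + \<sigma> * (t * partial_x h (\<sigma> * t, t)))) (at t)"
      using ds[of 0 \<sigma> t] by (auto intro!: derivative_eq_intros simp: algebra_simps)
    show "R < \<bar>t\<bar> \<Longrightarrow> t * h (\<sigma> * t, t) = 0"
      "R < \<bar>t\<bar> \<Longrightarrow> h (\<sigma> * t, t) + (t * partial_t h (\<sigma> * t, t) + \<sigma> * (t * partial_x h (\<sigma> * t, t))) = 0"
      using h_eq_0(2,3)[of t] x.h_eq_0(2,3)[of t] t.h_eq_0(2,3)[of t] by (cases "t \<le> 0"; simp)+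
  qed (intro continuous_intros x.continuous_compose t.continuous_compose)
  then show ?thesis
    using i x.ray_integrable[of \<sigma>] t.ray_integrable[of \<sigma>] by simp
qed

text \<open>Treats one conservation law with density q and flux q', so that it serves mass and
  momentum alike. With J the integral of \<open>\<psi>\<close> over the ray in t, the step functions
  contribute c J, the Rankine-Hugoniot deficit, and the delta measures contribute -c J.\<close>

lemma step_fun_delta_shock_equation:
  fixes q q' :: "real \<times> real \<Rightarrow> real"
  assumes "test_function \<psi>" and c: "c = \<sigma> * (r - l) - (r' - l')"
    and q: "q = step_fun \<sigma> l r" and q': "q' = step_fun \<sigma> l' r'"
    and w: "w = (\<lambda>t. t / sqrt (1 + \<sigma>\<^sup>2) * c)" and w': "w' = (\<lambda>t. \<sigma> * w t)"
  shows "singular_pairing \<sigma> q w (partial_t \<psi>) + singular_pairing \<sigma> q' w' (partial_x \<psi>) = 0"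
proof -
  obtain R where b: "box_function R \<psi>" "box_function R (partial_x \<psi>)" "box_function R (partial_t \<psi>)"
    and ds: "\<And>y \<sigma> t. ((\<lambda>t. \<psi> (y + \<sigma> * t, t)) has_real_derivative
          partial_t \<psi> (y + \<sigma> * t, t) + \<sigma> * partial_x \<psi> (y + \<sigma> * t, t)) (at t)"
    and dx: "\<And>x t. ((\<lambda>x. \<psi> (x, t)) has_real_derivative partial_x \<psi> (x, t)) (at x)"
    using test_function_derivatives[OF assms(1)] by metis
  have w'': "w' = (\<lambda>t. t / sqrt (1 + \<sigma>\<^sup>2) * (\<sigma> * c))" by (simp add: w w' mult_ac)
  let ?J = "\<integral>t. \<psi> (\<sigma> * t, t) \<partial>lborel"
  let ?T = "\<integral>t. t * partial_t \<psi> (\<sigma> * t, t) \<partial>lborel" and ?X = "\<integral>t. t * partial_x \<psi> (\<sigma> * t, t) \<partial>lborel"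
  have "singular_pairing \<sigma> q w (partial_t \<psi>) = - \<sigma> * ((l - r) * ?J) + c * ?T"
    unfolding w box_function.singular_pairing_linear_weight[OF b(3)] q
      box_function.pairing_partial_t[OF b(1-3) ds] box_function.pairing_partial_x[OF b(1,2) dx] ..
  moreover have "singular_pairing \<sigma> q' w' (partial_x \<psi>) = (l' - r') * ?J + \<sigma> * c * ?X"
    unfolding w'' box_function.singular_pairing_linear_weight[OF b(2)] q'
      box_function.pairing_partial_x[OF b(1,2) dx] ..
  moreover have "?T = - ?J - \<sigma> * ?X"
    using box_function.ray_integral_by_parts[OF b(1-3) ds, of \<sigma>] by linarith
  moreover have "- \<sigma> * ((l - r) * ?J) + c * (- ?J - \<sigma> * ?X) + ((l' - r') * ?J + \<sigma> * c * ?X) = 0"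
    unfolding c by (simp add: algebra_simps)
  ultimately show ?thesis by (simp only:)
qed

subsection \<open>The vanishing limit\<close>

text \<open>Along a sequence of parameters the intermediate states can be chosen as sequences, to
  which the limits of density, velocity and speeds apply.\<close>

lemma two_shock_solution_tendsto:
  fixes n \<alpha> B \<rho>m um \<rho>p up :: real and X :: "nat \<Rightarrow> real"
    and \<rho> u :: "nat \<Rightarrow> real \<times> real \<Rightarrow> real"
  assumes pos: "0 < \<rho>m" "0 < \<rho>p" "0 < B" "0 \<le> n" "0 < \<alpha>"
    and V: "(\<rho>p, up) \<in> region_V B \<alpha> \<rho>m um"
    and X: "\<And>k. 0 < X k" "X \<longlonglongrightarrow> 0"
    and sol: "\<And>k. two_shock_solution (X k) B n \<alpha> \<rho>m um \<rho>p up (\<rho> k) (u k)"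
    and h: "box_function R h"
  defines "\<sigma> \<equiv> sigmaB B \<alpha> \<rho>m um \<rho>p up"
  defines "c \<equiv> \<sigma> * (\<rho>p - \<rho>m) - (\<rho>p * up - \<rho>m * um)"
  shows "(\<lambda>k. pairing (\<rho> k) h) \<longlonglongrightarrow>
      pairing (step_fun \<sigma> \<rho>m \<rho>p) h + c * (\<integral>t. t * h (\<sigma> * t, t) \<partial>lborel)"
    and "(\<lambda>k. pairing (\<lambda>z. \<rho> k z * u k z) h) \<longlonglongrightarrow>
      pairing (step_fun \<sigma> (\<rho>m * um) (\<rho>p * up)) h + \<sigma> * c * (\<integral>t. t * h (\<sigma> * t, t) \<partial>lborel)"
proof -
  have V': "sqrt B * \<rho>m powr (- ((\<alpha> + 1) / 2)) + sqrt B * \<rho>p powr (- ((\<alpha> + 1) / 2)) \<le> um - up"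
    using V by (simp add: region_V_def)
  define P where "P k a v \<longleftrightarrow> max \<rho>m \<rho>p < a \<and> v - um = - Phi (X k) B n \<alpha> a \<rho>m \<and>
      up - v = - Phi (X k) B n \<alpha> \<rho>p a \<and>
      (\<forall>x t. t > 0 \<longrightarrow>
        (x / t < (a * v - \<rho>m * um) / (a - \<rho>m) \<longrightarrow> \<rho> k (x, t) = \<rho>m \<and> u k (x, t) = um) \<and>
        ((a * v - \<rho>m * um) / (a - \<rho>m) < x / t \<and> x / t < (\<rho>p * up - a * v) / (\<rho>p - a)
          \<longrightarrow> \<rho> k (x, t) = a \<and> u k (x, t) = v) \<and>
        (x / t > (\<rho>p * up - a * v) / (\<rho>p - a) \<longrightarrow> \<rho> k (x, t) = \<rho>p \<and> u k (x, t) = up))" for k a v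
  have "\<exists>a v. P k a v" for k
    unfolding P_def by (rule sol[unfolded two_shock_solution_def Let_def])
  then obtain a v where "\<And>k. P k (a k) (v k)" by metis
  note av = this[unfolded P_def]
  note a = av[THEN conjunct1]
  note vm = av[THEN conjunct2, THEN conjunct1]
  note vp = av[THEN conjunct2, THEN conjunct2, THEN conjunct1]
  have vm': "um - v k = Phi (X k) B n \<alpha> (a k) \<rho>m" for k using vm[of k] by linarith
  have vp': "v k - up = Phi (X k) B n \<alpha> (a k) \<rho>p" for k
    using vp[of k] Phi_commute[of "X k" B n \<alpha> \<rho>p "a k"] by linarith
  note vel = intermediate_velocity_tendsto[OF pos X a vm' vp' V', folded \<sigma>_def]
  define s1 s2 where "s1 k = (a k * v k - \<rho>m * um) / (a k - \<rho>m)"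
    and "s2 k = (\<rho>p * up - a k * v k) / (\<rho>p - a k)" for k
  have ak: "\<rho>m < a k" "\<rho>p < a k" for k using a[of k] by auto
  have speeds: "s1 \<longlonglongrightarrow> \<sigma>" "s2 \<longlonglongrightarrow> \<sigma>" "(\<lambda>k. a k * (s2 k - s1 k)) \<longlonglongrightarrow> c"
    unfolding s1_def[abs_def] s2_def[abs_def] c_def
    by (rule shock_speeds_tendsto[OF vel(1) ak vel(4)])+
  have le: "s1 k \<le> s2 k" for k
    unfolding s1_def s2_def using pos
    by (intro shock_speeds_tendsto(4)[OF vel(1) ak vel(4)] vel(2,3)) auto
  have st: "\<rho> k (x, t) = two_shock_fun (s1 k) (s2 k) \<rho>m (a k) \<rho>p (x, t)"
      "\<rho> k (x, t) * u k (x, t) = two_shock_fun (s1 k) (s2 k) (\<rho>m * um) (a k * v k) (\<rho>p * up) (x, t)"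
    if "0 < t" "x \<noteq> s1 k * t" "x \<noteq> s2 k * t" for k x t
  proof -
    have *: "x / t < s \<longleftrightarrow> x < s * t" "s < x / t \<longleftrightarrow> s * t < x" for s
      using that(1) by (auto simp: pos_divide_less_eq pos_less_divide_eq)
    have st: "x < s1 k * t \<longrightarrow> \<rho> k (x, t) = \<rho>m \<and> u k (x, t) = um"
      "s1 k * t < x \<and> x < s2 k * t \<longrightarrow> \<rho> k (x, t) = a k \<and> u k (x, t) = v k"
      "s2 k * t < x \<longrightarrow> \<rho> k (x, t) = \<rho>p \<and> u k (x, t) = up"
      using av[of k] that(1) unfolding s1_def[symmetric] s2_def[symmetric] *[symmetric] by blast+
    have "s1 k * t \<le> s2 k * t" using le[of k] that(1) by simp
    with st that(2,3) show "\<rho> k (x, t) = two_shock_fun (s1 k) (s2 k) \<rho>m (a k) \<rho>p (x, t)"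
      "\<rho> k (x, t) * u k (x, t) = two_shock_fun (s1 k) (s2 k) (\<rho>m * um) (a k * v k) (\<rho>p * up) (x, t)"
      by (auto simp: two_shock_fun_def)
  qed
  show "(\<lambda>k. pairing (\<rho> k) h) \<longlonglongrightarrow>
      pairing (step_fun \<sigma> \<rho>m \<rho>p) h + c * (\<integral>t. t * h (\<sigma> * t, t) \<partial>lborel)"
    by (rule box_function.pairing_two_shock_tendsto[OF h le speeds(1-3) st(1)])
  \<comment> \<open>The concentrated momentum is the concentrated mass c times the limit \<sigma> of
    the middle velocity.\<close>
  have "(\<lambda>k. v k * (a k * (s2 k - s1 k))) \<longlonglongrightarrow> \<sigma> * c"
    by (intro tendsto_mult vel speeds)
  then have mom: "(\<lambda>k. a k * v k * (s2 k - s1 k)) \<longlonglongrightarrow> \<sigma> * c" by (simp add: mult_ac)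
  show "(\<lambda>k. pairing (\<lambda>z. \<rho> k z * u k z) h) \<longlonglongrightarrow>
      pairing (step_fun \<sigma> (\<rho>m * um) (\<rho>p * up)) h + \<sigma> * c * (\<integral>t. t * h (\<sigma> * t, t) \<partial>lborel)"
    by (rule box_function.pairing_two_shock_tendsto[OF h le speeds(1,2) mom st(2)])
qed

theorem theorem5p1:
  fixes n \<alpha> B \<rho>m um \<rho>p up A0 :: real
    and \<rho> u :: "real \<Rightarrow> real \<times> real \<Rightarrow> real"
  assumes "1 \<le> n" "n \<le> 3" "0 < \<alpha>" "\<alpha> \<le> 1" "B > 0" "\<rho>m > 0" "\<rho>p > 0"
    and "(\<rho>p, up) \<in> region_V B \<alpha> \<rho>m um"
    and "A0 > 0"
    and "\<And>A. 0 < A \<Longrightarrow> A < A0 \<Longrightarrow> (\<rho>p, up) \<in> region_S1S2 A B n \<alpha> \<rho>m um"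
    and "\<And>A. 0 < A \<Longrightarrow> A < A0 \<Longrightarrow> two_shock_solution A B n \<alpha> \<rho>m um \<rho>p up (\<rho> A) (u A)"
  shows "let \<sigma> = sigmaB B \<alpha> \<rho>m um \<rho>p up;
             \<rho>0 = step_fun \<sigma> \<rho>m \<rho>p;
             u0 = step_fun \<sigma> um up;
             w1 = (\<lambda>t. t / sqrt (1 + \<sigma>\<^sup>2) * (\<sigma> * (\<rho>p - \<rho>m) - (\<rho>p * up - \<rho>m * um)));
             w2 = (\<lambda>t. t / sqrt (1 + \<sigma>\<^sup>2) *
                     (\<sigma> * (\<rho>p * up - \<rho>m * um) - (gcg_flux B \<alpha> \<rho>p up - gcg_flux B \<alpha> \<rho>m um)))
         in converges_as_distribution \<rho> (singular_pairing \<sigma> \<rho>0 w1) \<and>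
            converges_as_distribution (\<lambda>A z. \<rho> A z * u A z)
              (singular_pairing \<sigma> (step_fun \<sigma> (\<rho>m * um) (\<rho>p * up)) w2) \<and>
            delta_shock_solution B \<alpha> \<rho>m um \<rho>p up \<sigma> \<rho>0 u0 w1 w2"
proof -
  define \<sigma> where "\<sigma> = sigmaB B \<alpha> \<rho>m um \<rho>p up"
  define c where "c = \<sigma> * (\<rho>p - \<rho>m) - (\<rho>p * up - \<rho>m * um)"
  define d where "d = \<sigma> * (\<rho>p * up - \<rho>m * um) - (gcg_flux B \<alpha> \<rho>p up - gcg_flux B \<alpha> \<rho>m um)"
  define w1 w2 where "w1 = (\<lambda>t. t / sqrt (1 + \<sigma>\<^sup>2) * c)" and "w2 = (\<lambda>t. t / sqrt (1 + \<sigma>\<^sup>2) * d)"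
  have "sqrt B * \<rho>m powr (- ((\<alpha> + 1) / 2)) + sqrt B * \<rho>p powr (- ((\<alpha> + 1) / 2)) \<le> um - up"
    using assms(8) by (simp add: region_V_def)
  \<comment> \<open>The quadratic equation for \<sigma>, multiplied out, says that the stated
    momentum deficit d is \<sigma> times the mass deficit c.\<close>
  from sigmaB_root(3)[OF assms(6,7,5) this, folded \<sigma>_def]
  have d: "d = \<sigma> * c"
    unfolding d_def c_def gcg_flux_def by (simp add: power2_eq_square algebra_simps)
  have w2: "w2 = (\<lambda>t. \<sigma> * w1 t)" by (simp add: w1_def w2_def d mult_ac)
  \<comment> \<open>Restricting the filter to A < A0 makes every term of a test sequence an
    admissible parameter.\<close>
  have at_right: "at_right 0 = at 0 within {0<..<A0}"
    by (rule at_within_nhd[of _ "{..<A0}"]) (use assms(9) in auto)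
  have conv: "((\<lambda>A. pairing (\<rho> A) \<psi>) \<longlongrightarrow> singular_pairing \<sigma> (step_fun \<sigma> \<rho>m \<rho>p) w1 \<psi>) (at_right 0)"
    "((\<lambda>A. pairing (\<lambda>z. \<rho> A z * u A z) \<psi>) \<longlongrightarrow>
      singular_pairing \<sigma> (step_fun \<sigma> (\<rho>m * um) (\<rho>p * up)) w2 \<psi>) (at_right 0)"
    if \<psi>: "test_function \<psi>" for \<psi>
  proof -
    obtain R where R: "box_function R \<psi>" using test_function_derivatives[OF \<psi>] by metis
    have *: "(\<lambda>k. pairing (\<rho> (X k)) \<psi>) \<longlonglongrightarrow> singular_pairing \<sigma> (step_fun \<sigma> \<rho>m \<rho>p) w1 \<psi>"
      "(\<lambda>k. pairing (\<lambda>z. \<rho> (X k) z * u (X k) z) \<psi>) \<longlonglongrightarrow>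
        singular_pairing \<sigma> (step_fun \<sigma> (\<rho>m * um) (\<rho>p * up)) w2 \<psi>"
      if X: "\<And>k. X k \<in> {0<..<A0} - {0}" "X \<longlonglongrightarrow> 0" for X
    proof -
      have X': "0 < X k" "two_shock_solution (X k) B n \<alpha> \<rho>m um \<rho>p up (\<rho> (X k)) (u (X k))" for k
        using X(1)[of k] assms(11)[of "X k"] by auto
      have "0 \<le> n" using assms(1) by simp
      note two_shock_solution_tendsto[OF assms(6,7,5) this assms(3,8) X'(1) X(2) X'(2) R, folded \<sigma>_def, folded c_def]
      then show "(\<lambda>k. pairing (\<rho> (X k)) \<psi>) \<longlonglongrightarrow> singular_pairing \<sigma> (step_fun \<sigma> \<rho>m \<rho>p) w1 \<psi>"
        "(\<lambda>k. pairing (\<lambda>z. \<rho> (X k) z * u (X k) z) \<psi>) \<longlonglongrightarrow>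
          singular_pairing \<sigma> (step_fun \<sigma> (\<rho>m * um) (\<rho>p * up)) w2 \<psi>"
        unfolding w1_def w2_def d box_function.singular_pairing_linear_weight[OF R] by auto
    qed
    show "((\<lambda>A. pairing (\<rho> A) \<psi>) \<longlongrightarrow> singular_pairing \<sigma> (step_fun \<sigma> \<rho>m \<rho>p) w1 \<psi>) (at_right 0)"
      "((\<lambda>A. pairing (\<lambda>z. \<rho> A z * u A z) \<psi>) \<longlongrightarrow>
        singular_pairing \<sigma> (step_fun \<sigma> (\<rho>m * um) (\<rho>p * up)) w2 \<psi>) (at_right 0)"
      unfolding at_right tendsto_at_iff_sequentially comp_def using * by blast+
  qed
  have prod: "(\<lambda>z. step_fun \<sigma> \<rho>m \<rho>p z * step_fun \<sigma> um up z) = step_fun \<sigma> (\<rho>m * um) (\<rho>p * up)"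
    by (auto simp: step_fun_def)
  have flux: "(\<lambda>z. gcg_flux B \<alpha> (step_fun \<sigma> \<rho>m \<rho>p z) (step_fun \<sigma> um up z)) =
      step_fun \<sigma> (gcg_flux B \<alpha> \<rho>m um) (gcg_flux B \<alpha> \<rho>p up)"
    by (auto simp: step_fun_def)
  have "delta_shock_solution B \<alpha> \<rho>m um \<rho>p up \<sigma> (step_fun \<sigma> \<rho>m \<rho>p) (step_fun \<sigma> um up) w1 w2"
    unfolding delta_shock_solution_def prod flux
  proof (intro conjI allI impI)
    fix \<psi> assume \<psi>: "test_function \<psi>"
    \<comment> \<open>In the mass equation the flux weight \<open>w2\<close> is \<sigma> times
      \<open>w1\<close> by d = \<sigma> c; in the momentum equation the factor \<sigma> is part of
      the definition of the flux.\<close>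
    show "singular_pairing \<sigma> (step_fun \<sigma> \<rho>m \<rho>p) w1 (partial_t \<psi>) +
        singular_pairing \<sigma> (step_fun \<sigma> (\<rho>m * um) (\<rho>p * up)) w2 (partial_x \<psi>) = 0"
      by (rule step_fun_delta_shock_equation[OF \<psi> c_def refl refl w1_def w2])
    show "singular_pairing \<sigma> (step_fun \<sigma> (\<rho>m * um) (\<rho>p * up)) w2 (partial_t \<psi>) +
        singular_pairing \<sigma> (step_fun \<sigma> (gcg_flux B \<alpha> \<rho>m um) (gcg_flux B \<alpha> \<rho>p up))
          (\<lambda>t. \<sigma> * w2 t) (partial_x \<psi>) = 0"
      by (rule step_fun_delta_shock_equation[OF \<psi> d_def refl refl w2_def refl])
  qed (auto simp: step_fun_def)
  then show ?thesis
    unfolding Let_def converges_as_distribution_def \<sigma>_def[symmetric]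
    unfolding c_def[symmetric] d_def[symmetric] w1_def[symmetric] w2_def[symmetric]
    using conv by blast
qed

end
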